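(* Let $Q$ be a Buchsteiner loop of order less than $64$ that is not conjugacy closed. Then $|Q|=32$, $Q/N(Q)$ is elementary abelian of order $8$, and $Z(Q)=A(Q)$ is of order $2$. The group $Q/Z(Q)$ is a nonabelian group of order $16$.
   Context: A Buchsteiner loop is a loop $Q$ satisfying $x\backslash (xy\cdot z) = (y\cdot zx)/x$ for all $x,y,z$, where $\backslash$ and $/$ are left and right division. The nucleus $N(Q)$ is the set of all $a$ such that $a(xy)=(ax)y$, $x(ay)=(xa)y$ and $x(ya)=(xy)a$ for all $x,y\in Q$; in a Buchsteiner loop it is a normal subloop. The centre $Z(Q)$ is the set of elements of $N(Q)$ commuting with all elements of $Q$. $A(Q)$ is the least normal subloop $A$ of $Q$ such that $Q/A$ is a group. A loop is conjugacy closed if for all $x,y$ the conjugate $L_xL_yL_x^{-1}$ is a left translation and $R_xR_yR_x^{-1}$ is a right translation, where $L_x(y)=xy$, $R_x(y)=yx$. *)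

theory Defs
  imports
    "HOL-Algebra.Coset"
    "HOL-Algebra.Bij"
    "HOL-Computational_Algebra.Primes"
begin

text \<open>Loops live on the record type that HOL-Algebra uses for monoids, so that
  cosets, \<open>Mod\<close>, \<open>order\<close>, \<open>group\<close> and \<open>comm_group\<close> can be reused.\<close>

locale loop =
  fixes Q (structure)
  assumes mult_closed: "\<lbrakk>x \<in> carrier Q; y \<in> carrier Q\<rbrakk> \<Longrightarrow> x \<otimes> y \<in> carrier Q"
    and one_closed: "\<one> \<in> carrier Q"
    and left_one: "x \<in> carrier Q \<Longrightarrow> \<one> \<otimes> x = x"
    and right_one: "x \<in> carrier Q \<Longrightarrow> x \<otimes> \<one> = x"
    and left_div: "\<lbrakk>x \<in> carrier Q; y \<in> carrier Q\<rbrakk> \<Longrightarrow> \<exists>!z. z \<in> carrier Q \<and> x \<otimes> z = y"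
    and right_div: "\<lbrakk>x \<in> carrier Q; y \<in> carrier Q\<rbrakk> \<Longrightarrow> \<exists>!z. z \<in> carrier Q \<and> z \<otimes> x = y"

text \<open>\<open>ldiv Q x y\<close> is \<open>x\y\<close> (divide \<open>y\<close> by \<open>x\<close> on the left), whereas \<open>rdiv Q y x\<close> is
  \<open>y/x\<close> (divide \<open>y\<close> by \<open>x\<close> on the right).\<close>

definition ldiv :: "('a, 'b) monoid_scheme \<Rightarrow> 'a \<Rightarrow> 'a \<Rightarrow> 'a" where
  "ldiv Q x y = (THE z. z \<in> carrier Q \<and> x \<otimes>\<^bsub>Q\<^esub> z = y)"

definition rdiv :: "('a, 'b) monoid_scheme \<Rightarrow> 'a \<Rightarrow> 'a \<Rightarrow> 'a" where
  "rdiv Q y x = (THE z. z \<in> carrier Q \<and> z \<otimes>\<^bsub>Q\<^esub> x = y)"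

locale buchsteiner_loop = loop +
  assumes buchsteiner: "\<lbrakk>x \<in> carrier Q; y \<in> carrier Q; z \<in> carrier Q\<rbrakk> \<Longrightarrow>
    ldiv Q x ((x \<otimes> y) \<otimes> z) = rdiv Q (y \<otimes> (z \<otimes> x)) x"

definition subloop :: "'a set \<Rightarrow> ('a, 'b) monoid_scheme \<Rightarrow> bool" where
  "subloop N Q \<longleftrightarrow> N \<subseteq> carrier Q \<and> \<one>\<^bsub>Q\<^esub> \<in> N \<and>
    (\<forall>x\<in>N. \<forall>y\<in>N. x \<otimes>\<^bsub>Q\<^esub> y \<in> N \<and> ldiv Q x y \<in> N \<and> rdiv Q y x \<in> N)"

text \<open>Bruck's coset conditions \<open>xN = Nx\<close>, \<open>x(yN) = (xy)N\<close>, \<open>(Nx)y = N(xy)\<close>. They make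
  \<open>(Nx)(Ny) = N(xy)\<close> for the product of subsets, so that \<open>Q Mod N\<close> is the quotient
  loop \<open>Q/N\<close>.\<close>

definition normal_subloop :: "'a set \<Rightarrow> ('a, 'b) monoid_scheme \<Rightarrow> bool" where
  "normal_subloop N Q \<longleftrightarrow> subloop N Q \<and>
    (\<forall>x\<in>carrier Q. x <#\<^bsub>Q\<^esub> N = N #>\<^bsub>Q\<^esub> x) \<and>
    (\<forall>x\<in>carrier Q. \<forall>y\<in>carrier Q.
      x <#\<^bsub>Q\<^esub> (y <#\<^bsub>Q\<^esub> N) = (x \<otimes>\<^bsub>Q\<^esub> y) <#\<^bsub>Q\<^esub> N \<and>
      (N #>\<^bsub>Q\<^esub> x) #>\<^bsub>Q\<^esub> y = N #>\<^bsub>Q\<^esub> (x \<otimes>\<^bsub>Q\<^esub> y))"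

definition nucleus :: "('a, 'b) monoid_scheme \<Rightarrow> 'a set" where
  "nucleus Q = {a \<in> carrier Q. \<forall>x\<in>carrier Q. \<forall>y\<in>carrier Q.
     a \<otimes>\<^bsub>Q\<^esub> (x \<otimes>\<^bsub>Q\<^esub> y) = (a \<otimes>\<^bsub>Q\<^esub> x) \<otimes>\<^bsub>Q\<^esub> y \<and>
     x \<otimes>\<^bsub>Q\<^esub> (a \<otimes>\<^bsub>Q\<^esub> y) = (x \<otimes>\<^bsub>Q\<^esub> a) \<otimes>\<^bsub>Q\<^esub> y \<and>
     x \<otimes>\<^bsub>Q\<^esub> (y \<otimes>\<^bsub>Q\<^esub> a) = (x \<otimes>\<^bsub>Q\<^esub> y) \<otimes>\<^bsub>Q\<^esub> a}"

definition loop_centre :: "('a, 'b) monoid_scheme \<Rightarrow> 'a set" where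
  "loop_centre Q = {a \<in> nucleus Q. \<forall>x\<in>carrier Q. a \<otimes>\<^bsub>Q\<^esub> x = x \<otimes>\<^bsub>Q\<^esub> a}"

text \<open>\<open>A(Q)\<close>. The order on sets is inclusion; in every loop the least such subloop exists,
  since it is the intersection of all of them.\<close>

definition associator_subloop :: "('a, 'b) monoid_scheme \<Rightarrow> 'a set" where
  "associator_subloop Q = (LEAST A. normal_subloop A Q \<and> group (Q Mod A))"

text \<open>Translations are restricted to the carrier, as required for membership in the
  symmetric group \<open>BijGroup (carrier Q)\<close>, whose product is composition of maps
  (right factor applied first).\<close>

definition ltrans :: "('a, 'b) monoid_scheme \<Rightarrow> 'a \<Rightarrow> 'a \<Rightarrow> 'a" where
  "ltrans Q x = (\<lambda>y\<in>carrier Q. x \<otimes>\<^bsub>Q\<^esub> y)"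

definition rtrans :: "('a, 'b) monoid_scheme \<Rightarrow> 'a \<Rightarrow> 'a \<Rightarrow> 'a" where
  "rtrans Q x = (\<lambda>y\<in>carrier Q. y \<otimes>\<^bsub>Q\<^esub> x)"

definition conjugacy_closed :: "('a, 'b) monoid_scheme \<Rightarrow> bool" where
  "conjugacy_closed Q \<longleftrightarrow> (let S = BijGroup (carrier Q) in
    \<forall>x\<in>carrier Q. \<forall>y\<in>carrier Q.
      ltrans Q x \<otimes>\<^bsub>S\<^esub> ltrans Q y \<otimes>\<^bsub>S\<^esub> inv\<^bsub>S\<^esub> ltrans Q x \<in> ltrans Q ` carrier Q \<and>
      rtrans Q x \<otimes>\<^bsub>S\<^esub> rtrans Q y \<otimes>\<^bsub>S\<^esub> inv\<^bsub>S\<^esub> rtrans Q x \<in> rtrans Q ` carrier Q)"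

definition elementary_abelian :: "('a, 'b) monoid_scheme \<Rightarrow> bool" where
  "elementary_abelian G \<longleftrightarrow> comm_group G \<and>
    (\<exists>p::nat. prime p \<and> (\<forall>x\<in>carrier G. x [^]\<^bsub>G\<^esub> p = \<one>\<^bsub>G\<^esub>))"

end

theory Submission
  imports Defs
begin

text \<open>The Buchsteiner law says that \<open>B\<^bsub>x\<^esub> = (L\<^bsub>x\<^esub>, R\<^bsub>x\<^esub>\<^sup>-\<^sup>1, L\<^bsub>x\<^esub> R\<^bsub>x\<^esub>\<^sup>-\<^sup>1)\<close> is an autotopism for every
  \<open>x\<close>, and it makes \<open>xy \<cdot> z = x \<cdot> yz\<close> invariant under cyclic shifts of \<open>x, y, z\<close>. All elements
  \<open>x (1 / x)\<close> turn out to be nuclear, which gives the doubly weak inverse property. That property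
  acts on autotopisms and yields isomorphisms of \<open>Q\<close> onto its principal isotopes; as these satisfy
  the Buchsteiner law too, \<open>xy\<close> and \<open>yx\<close> agree modulo \<open>N(Q)\<close>, and \<open>Q/N(Q)\<close> is an abelian group.

  The associator then lives in the centre of \<open>N(Q)\<close>, on which \<open>Q/N(Q)\<close> acts by conjugation; it is
  a crossed homomorphism in each argument, and squares act trivially on its values. Its asymmetry in
  the first two arguments is trilinear with central values of order at most 2, and vanishes exactly
  in conjugacy closed loops. If it does not vanish, its kernels bound \<open>|Q/N(Q)|\<close> below by 8, so that
  \<open>|N(Q)| < 8\<close>. Comparing commutators of products shows that the asymmetry dies under every
  homomorphism on \<open>N(Q)\<close> that is blind to the action of \<open>Q\<close>; this leaves \<open>|N(Q)| = 4\<close> with a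
  nontrivial action and excludes a commutative \<open>Q/Z(Q)\<close>.\<close>

section \<open>Loop calculus: divisions, automorphisms, left inner mappings, nuclear
  elements\<close>

context loop
begin

abbreviation ldivide (infixl "\<setminus>" 70) where "x \<setminus> y \<equiv> ldiv Q x y"
abbreviation rdivide (infixl "\<oslash>" 70) where "y \<oslash> x \<equiv> rdiv Q y x"
abbreviation C where "C \<equiv> carrier Q"
abbreviation N where "N \<equiv> nucleus Q"

declare mult_closed [simp] one_closed [simp] left_one [simp] right_one [simp]

lemma ldiv_prop:
  assumes "x \<in> C" "y \<in> C"
  shows "x \<setminus> y \<in> C \<and> x \<otimes> (x \<setminus> y) = y"
  unfolding ldiv_def by (rule theI') (rule left_div[OF assms])

lemma rdiv_prop:
  assumes "x \<in> C" "y \<in> C"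
  shows "y \<oslash> x \<in> C \<and> (y \<oslash> x) \<otimes> x = y"
  unfolding rdiv_def by (rule theI') (rule right_div[OF assms])

lemma ldiv_closed [simp]: "\<lbrakk>x \<in> C; y \<in> C\<rbrakk> \<Longrightarrow> x \<setminus> y \<in> C"
  and mult_ldiv [simp]: "\<lbrakk>x \<in> C; y \<in> C\<rbrakk> \<Longrightarrow> x \<otimes> (x \<setminus> y) = y"
  and rdiv_closed [simp]: "\<lbrakk>x \<in> C; y \<in> C\<rbrakk> \<Longrightarrow> y \<oslash> x \<in> C"
  and rdiv_mult [simp]: "\<lbrakk>x \<in> C; y \<in> C\<rbrakk> \<Longrightarrow> (y \<oslash> x) \<otimes> x = y"
  using ldiv_prop rdiv_prop by blast+

lemma left_cancel [simp]: "\<lbrakk>x \<in> C; y \<in> C; z \<in> C\<rbrakk> \<Longrightarrow> x \<otimes> y = x \<otimes> z \<longleftrightarrow> y = z"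
  using left_div[of x "x \<otimes> y"] mult_closed by metis

lemma right_cancel [simp]: "\<lbrakk>x \<in> C; y \<in> C; z \<in> C\<rbrakk> \<Longrightarrow> y \<otimes> x = z \<otimes> x \<longleftrightarrow> y = z"
  using right_div[of x "y \<otimes> x"] mult_closed by metis

lemma ldiv_mult [simp]: "\<lbrakk>x \<in> C; y \<in> C\<rbrakk> \<Longrightarrow> x \<setminus> (x \<otimes> y) = y"
  using left_cancel[of x "x \<setminus> (x \<otimes> y)" y] mult_ldiv ldiv_closed mult_closed by metis

lemma mult_rdiv [simp]: "\<lbrakk>x \<in> C; y \<in> C\<rbrakk> \<Longrightarrow> (y \<otimes> x) \<oslash> x = y"
  using right_cancel[of x "(y \<otimes> x) \<oslash> x" y] rdiv_mult rdiv_closed mult_closed by metis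

lemma ldiv_eqI: "\<lbrakk>x \<in> C; z \<in> C; x \<otimes> z = y\<rbrakk> \<Longrightarrow> x \<setminus> y = z"
  by auto

lemma rdiv_eqI: "\<lbrakk>x \<in> C; z \<in> C; z \<otimes> x = y\<rbrakk> \<Longrightarrow> y \<oslash> x = z"
  by auto

lemma rdiv_self [simp]: "x \<in> C \<Longrightarrow> x \<oslash> x = \<one>"
  by (rule rdiv_eqI) auto

lemma one_ldiv [simp]: "x \<in> C \<Longrightarrow> \<one> \<setminus> x = x"
  by (rule ldiv_eqI) auto

lemma mult_eq_self [simp]: "\<lbrakk>x \<in> C; y \<in> C\<rbrakk> \<Longrightarrow> x \<otimes> y = x \<longleftrightarrow> y = \<one>"
  using left_cancel[of x y \<one>] by simp

lemma rdiv_ldiv [simp]: "\<lbrakk>x \<in> C; y \<in> C\<rbrakk> \<Longrightarrow> y \<oslash> (x \<setminus> y) = x"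
  by (rule rdiv_eqI) auto

lemma ldiv_rdiv [simp]: "\<lbrakk>x \<in> C; y \<in> C\<rbrakk> \<Longrightarrow> (y \<oslash> x) \<setminus> y = x"
  by (rule ldiv_eqI) auto

abbreviation linv ("J") where "J x \<equiv> \<one> \<oslash> x"
abbreviation rinv ("I") where "I x \<equiv> x \<setminus> \<one>"

definition automorphism :: "('a \<Rightarrow> 'a) \<Rightarrow> bool" where
  "automorphism h \<longleftrightarrow> bij_betw h C C \<and> (\<forall>x\<in>C. \<forall>y\<in>C. h (x \<otimes> y) = h x \<otimes> h y)"

lemma aut_closed [simp]: "\<lbrakk>automorphism h; x \<in> C\<rbrakk> \<Longrightarrow> h x \<in> C"
  unfolding automorphism_def by (auto dest: bij_betwE)

lemma aut_mult: "\<lbrakk>automorphism h; x \<in> C; y \<in> C\<rbrakk> \<Longrightarrow> h (x \<otimes> y) = h x \<otimes> h y"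
  unfolding automorphism_def by auto

lemma aut_inj: "\<lbrakk>automorphism h; x \<in> C; y \<in> C; h x = h y\<rbrakk> \<Longrightarrow> x = y"
  unfolding automorphism_def bij_betw_def inj_on_def by auto

lemma aut_surj: "\<lbrakk>automorphism h; y \<in> C\<rbrakk> \<Longrightarrow> \<exists>x\<in>C. y = h x"
  unfolding automorphism_def bij_betw_def by auto

lemma aut_one: "automorphism h \<Longrightarrow> h \<one> = \<one>"
  using aut_mult[of h \<one> \<one>] mult_eq_self[of "h \<one>" "h \<one>"] by simp

lemma aut_ldiv: "\<lbrakk>automorphism h; x \<in> C; y \<in> C\<rbrakk> \<Longrightarrow> h (x \<setminus> y) = h x \<setminus> h y"
  by (rule ldiv_eqI[symmetric]) (auto simp flip: aut_mult)

lemma rdiv_cancel [simp]: "\<lbrakk>x \<in> C; y \<in> C; z \<in> C\<rbrakk> \<Longrightarrow> y \<oslash> x = z \<oslash> x \<longleftrightarrow> y = z"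
  using right_cancel[of x "y \<oslash> x" "z \<oslash> x"] by auto

lemma ldiv_cancel [simp]: "\<lbrakk>x \<in> C; y \<in> C; z \<in> C\<rbrakk> \<Longrightarrow> x \<setminus> y = x \<setminus> z \<longleftrightarrow> y = z"
  using left_cancel[of x "x \<setminus> y" "x \<setminus> z"] by auto

lemma aut_rdiv: "\<lbrakk>automorphism h; x \<in> C; y \<in> C\<rbrakk> \<Longrightarrow> h (x \<oslash> y) = h x \<oslash> h y"
  by (rule rdiv_eqI[symmetric]) (auto simp flip: aut_mult)

text \<open>In terms of left translations, \<open>assoc_map x y\<close> is the left inner mapping
  L_{xy}^-1 L_x L_y.\<close>

definition assoc_map :: "'a \<Rightarrow> 'a \<Rightarrow> 'a \<Rightarrow> 'a" where
  "assoc_map x y z = (x \<otimes> y) \<setminus> (x \<otimes> (y \<otimes> z))"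

lemma assoc_map_closed [simp]: "\<lbrakk>x \<in> C; y \<in> C; z \<in> C\<rbrakk> \<Longrightarrow> assoc_map x y z \<in> C"
  unfolding assoc_map_def by simp

lemma mult_assoc_map: "\<lbrakk>x \<in> C; y \<in> C; z \<in> C\<rbrakk> \<Longrightarrow> (x \<otimes> y) \<otimes> assoc_map x y z = x \<otimes> (y \<otimes> z)"
  unfolding assoc_map_def by simp

lemma assoc_map_eqI:
  "\<lbrakk>x \<in> C; y \<in> C; w \<in> C; (x \<otimes> y) \<otimes> w = x \<otimes> (y \<otimes> z)\<rbrakk> \<Longrightarrow> assoc_map x y z = w"
  unfolding assoc_map_def by (rule ldiv_eqI) auto

lemma assoc_map_one [simp]: "\<lbrakk>x \<in> C; y \<in> C\<rbrakk> \<Longrightarrow> assoc_map x y \<one> = \<one>"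
  by (rule assoc_map_eqI) auto

lemma assoc_map_bij:
  assumes "x \<in> C" "y \<in> C" shows "bij_betw (assoc_map x y) C C"
proof (rule bij_betw_byWitness[where f' = "\<lambda>w. y \<setminus> (x \<setminus> ((x \<otimes> y) \<otimes> w))"])
  show "\<forall>a\<in>C. y \<setminus> (x \<setminus> ((x \<otimes> y) \<otimes> assoc_map x y a)) = a"
    using assms by (simp add: mult_assoc_map)
  show "\<forall>a\<in>C. assoc_map x y (y \<setminus> (x \<setminus> ((x \<otimes> y) \<otimes> a))) = a"
    using assms by (auto intro!: assoc_map_eqI)
qed (use assms in auto)

lemma aut_assoc_map:
  "\<lbrakk>automorphism h; x \<in> C; y \<in> C; z \<in> C\<rbrakk>
    \<Longrightarrow> h (assoc_map x y z) = assoc_map (h x) (h y) (h z)"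
  unfolding assoc_map_def by (simp add: aut_ldiv aut_mult)

lemma nucleusD:
  assumes "a \<in> N"
  shows nuc_carrier [simp]: "a \<in> C"
    and nuc_left: "\<lbrakk>x \<in> C; y \<in> C\<rbrakk> \<Longrightarrow> (a \<otimes> x) \<otimes> y = a \<otimes> (x \<otimes> y)"
    and nuc_mid: "\<lbrakk>x \<in> C; y \<in> C\<rbrakk> \<Longrightarrow> (x \<otimes> a) \<otimes> y = x \<otimes> (a \<otimes> y)"
    and nuc_right: "\<lbrakk>x \<in> C; y \<in> C\<rbrakk> \<Longrightarrow> (x \<otimes> y) \<otimes> a = x \<otimes> (y \<otimes> a)"
  using assms unfolding nucleus_def by auto

lemmas nuc = nuc_left nuc_mid nuc_right

end

section \<open>The Buchsteiner law, inner mappings and the nucleus\<close>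

context buchsteiner_loop
begin

text \<open>Substituting \<open>v \<oslash> x\<close> for the last variable of the law gives its
  autotopism form, which is the one suited to composition.\<close>

lemma mult_rdiv_distrib:
  assumes "x \<in> C" "u \<in> C" "v \<in> C"
  shows "(x \<otimes> u) \<otimes> (v \<oslash> x) = x \<otimes> ((u \<otimes> v) \<oslash> x)"
proof -
  have "x \<setminus> ((x \<otimes> u) \<otimes> (v \<oslash> x)) = (u \<otimes> v) \<oslash> x"
    using buchsteiner[of x u "v \<oslash> x"] assms by simp
  then show ?thesis
    using assms mult_ldiv[of x "(x \<otimes> u) \<otimes> (v \<oslash> x)"] by simp
qed

text \<open>With \<open>assoc_map x y z\<close> as last variable, the left side of the law becomes
  \<open>y \<otimes> z\<close>.\<close>

lemma assoc_map_rotate: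
  assumes "x \<in> C" "y \<in> C" "z \<in> C"
  shows "(y \<otimes> z) \<otimes> x = y \<otimes> (assoc_map x y z \<otimes> x)"
proof -
  have "y \<otimes> z = (y \<otimes> (assoc_map x y z \<otimes> x)) \<oslash> x"
    using buchsteiner[of x y "assoc_map x y z"] assms by (simp add: mult_assoc_map)
  then show ?thesis using assms by simp
qed

text \<open>The law at \<open>y\<close>, read with \<open>assoc_map_rotate\<close>: the left inner
  mapping is also R_x^-1 R_y^-1 R_{xy}.\<close>

lemma assoc_map_right:
  assumes "x \<in> C" "y \<in> C" "z \<in> C"
  shows "z \<otimes> (x \<otimes> y) = (assoc_map x y z \<otimes> x) \<otimes> y"
proof -
  have "assoc_map x y z \<otimes> x = (z \<otimes> (x \<otimes> y)) \<oslash> y"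
    using buchsteiner[of y z x] assms by (simp add: assoc_map_rotate)
  then show ?thesis using assms by simp
qed

lemma assoc_map_trivial_iff:
  assumes "x \<in> C" "y \<in> C" "z \<in> C"
  shows "(x \<otimes> y) \<otimes> z = x \<otimes> (y \<otimes> z) \<longleftrightarrow> assoc_map x y z = z"
  using left_cancel[of "x \<otimes> y" z "assoc_map x y z"] mult_assoc_map[OF assms] assms by auto

text \<open>Both equations say that \<open>assoc_map x y\<close> fixes \<open>z\<close>; for the
  shifted triple this is \<open>assoc_map_rotate\<close>.\<close>

lemma assoc_cyclic:
  assumes "x \<in> C" "y \<in> C" "z \<in> C"
  shows "(x \<otimes> y) \<otimes> z = x \<otimes> (y \<otimes> z) \<longleftrightarrow> (y \<otimes> z) \<otimes> x = y \<otimes> (z \<otimes> x)"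
  unfolding assoc_map_trivial_iff[OF assms] assoc_map_rotate[OF assms] using assms by simp

text \<open>Cyclic shifts carry the left slot to the two others, so the left, middle and right
  nuclei coincide.\<close>

lemma nucleusI_left:
  assumes "a \<in> C" and a: "\<And>x y. \<lbrakk>x \<in> C; y \<in> C\<rbrakk> \<Longrightarrow> (a \<otimes> x) \<otimes> y = a \<otimes> (x \<otimes> y)"
  shows "a \<in> N"
  unfolding nucleus_def
proof (intro CollectI conjI ballI)
  fix x y assume xy: "x \<in> C" "y \<in> C"
  show "a \<otimes> (x \<otimes> y) = (a \<otimes> x) \<otimes> y" using a[OF xy] by simp
  show "x \<otimes> (a \<otimes> y) = (x \<otimes> a) \<otimes> y"
    using assoc_cyclic[of x a y] a[of y x] xy assms(1) by simp
  show "x \<otimes> (y \<otimes> a) = (x \<otimes> y) \<otimes> a"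
    using assoc_cyclic[of x y a] assoc_cyclic[of y a x] a[of x y] xy assms(1) by simp
qed (rule assms(1))

lemma nucleusI_mid:
  assumes "a \<in> C" and a: "\<And>x y. \<lbrakk>x \<in> C; y \<in> C\<rbrakk> \<Longrightarrow> (x \<otimes> a) \<otimes> y = x \<otimes> (a \<otimes> y)"
  shows "a \<in> N"
proof (rule nucleusI_left)
  fix x y assume xy: "x \<in> C" "y \<in> C"
  show "(a \<otimes> x) \<otimes> y = a \<otimes> (x \<otimes> y)"
    using assoc_cyclic[of a x y] assoc_cyclic[of x y a] a[of y x] xy assms(1) by simp
qed (rule assms(1))

lemma nucleusI_right:
  assumes "a \<in> C" and a: "\<And>x y. \<lbrakk>x \<in> C; y \<in> C\<rbrakk> \<Longrightarrow> (x \<otimes> y) \<otimes> a = x \<otimes> (y \<otimes> a)"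
  shows "a \<in> N"
proof (rule nucleusI_left)
  fix x y assume xy: "x \<in> C" "y \<in> C"
  show "(a \<otimes> x) \<otimes> y = a \<otimes> (x \<otimes> y)"
    using assoc_cyclic[of a x y] assoc_cyclic[of x y a] a[of x y] xy assms(1) by simp
qed (rule assms(1))

text \<open>The autotopism \<open>B\<^bsub>xy\<^esub>\<^sup>-\<^sup>1 B\<^bsub>x\<^esub> B\<^bsub>y\<^esub>\<close> has first component \<open>assoc_map x y\<close>; the companion is the image
  of \<open>1\<close> under its second component.\<close>

definition companion :: "'a \<Rightarrow> 'a \<Rightarrow> 'a" where
  "companion x y = (J y \<oslash> x) \<otimes> (x \<otimes> y)"

lemma companion_closed [simp]: "\<lbrakk>x \<in> C; y \<in> C\<rbrakk> \<Longrightarrow> companion x y \<in> C"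
  unfolding companion_def by simp

text \<open>The second and third components of the autotopism with first component
  \<open>assoc_map x y\<close> both equal the map \<open>h\<close> of the proof, and the companion
  is \<open>h \<one>\<close>.\<close>

lemma assoc_map_pseudo:
  assumes [simp]: "x \<in> C" "y \<in> C" "u \<in> C" "v \<in> C"
  shows "assoc_map x y u \<otimes> (assoc_map x y v \<otimes> companion x y)
    = assoc_map x y (u \<otimes> v) \<otimes> companion x y"
proof -
  define p where "p = x \<otimes> y"
  define h where "h = (\<lambda>w. ((w \<oslash> y) \<oslash> x) \<otimes> p)"
  have [simp]: "p \<in> C" by (simp add: p_def)
  have [simp]: "h w \<in> C" if "w \<in> C" for w
    using that by (simp add: h_def)
  have key: "assoc_map x y s \<otimes> h t = h (s \<otimes> t)" if [simp]: "s \<in> C" "t \<in> C" for s t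
  proof -
    have eq: "p \<otimes> ((assoc_map x y s \<otimes> h t) \<oslash> p) = x \<otimes> ((y \<otimes> ((s \<otimes> t) \<oslash> y)) \<oslash> x)"
      if [simp]: "s \<in> C" "t \<in> C" for s t
    proof -
      have "p \<otimes> ((assoc_map x y s \<otimes> h t) \<oslash> p) = (p \<otimes> assoc_map x y s) \<otimes> (h t \<oslash> p)"
        by (simp add: mult_rdiv_distrib)
      also have "\<dots> = (x \<otimes> (y \<otimes> s)) \<otimes> ((t \<oslash> y) \<oslash> x)"
        by (simp add: h_def p_def mult_assoc_map)
      also have "\<dots> = x \<otimes> ((y \<otimes> ((s \<otimes> t) \<oslash> y)) \<oslash> x)"
        by (simp add: mult_rdiv_distrib)
      finally show ?thesis .
    qed
    \<comment> \<open>The right side of \<open>eq\<close> depends only on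
      \<open>s \<otimes> t\<close>, so \<open>s, t\<close> may be replaced by
      \<open>\<one>, s \<otimes> t\<close>; and \<open>assoc_map x y\<close> fixes
      \<open>\<one>\<close>.\<close>
    have "p \<otimes> ((assoc_map x y s \<otimes> h t) \<oslash> p) = p \<otimes> ((assoc_map x y \<one> \<otimes> h (s \<otimes> t)) \<oslash> p)"
      using eq[of s t] eq[of \<one> "s \<otimes> t"] by simp
    then show ?thesis
      by simp
  qed
  have h: "h t = assoc_map x y t \<otimes> companion x y" if [simp]: "t \<in> C" for t
    using key[of t \<one>] by (simp add: h_def p_def companion_def)
  show ?thesis using key[of u v] by (simp add: h)
qed

lemma assoc_map_aut_if_nuclear_companion:
  assumes [simp]: "x \<in> C" "y \<in> C" and c: "companion x y \<in> N"
  shows "automorphism (assoc_map x y)"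
  unfolding automorphism_def
proof (intro conjI ballI)
  fix u v assume [simp]: "u \<in> C" "v \<in> C"
  have "(assoc_map x y u \<otimes> assoc_map x y v) \<otimes> companion x y = assoc_map x y (u \<otimes> v) \<otimes> companion x y"
    using assoc_map_pseudo[of x y u v] c by (simp add: nuc)
  then show "assoc_map x y (u \<otimes> v) = assoc_map x y u \<otimes> assoc_map x y v"
    by simp
qed (rule assoc_map_bij; simp)

lemma one_nuc [simp]: "\<one> \<in> N"
  unfolding nucleus_def by simp

lemma nuc_mult [simp]:
  assumes "a \<in> N" "b \<in> N" shows "a \<otimes> b \<in> N"
  using assms by (intro nucleusI_left) (auto simp: nuc)

lemma nuc_I_eq_J: assumes "a \<in> N" shows "I a = J a"
proof -
  have "a \<otimes> (I a \<otimes> a) = a \<otimes> \<one>" using assms nuc_left[of a "I a" a] by simp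
  then have "I a \<otimes> a = \<one>" using assms by (simp del: right_one)
  then show ?thesis using assms by (intro rdiv_eqI[symmetric]) auto
qed

lemma nuc_mult_inv [simp]:
  assumes "a \<in> N" shows "a \<otimes> J a = \<one>" "J a \<otimes> a = \<one>"
  using assms mult_ldiv[of a \<one>] nuc_I_eq_J[of a] by simp_all

lemma nuc_inv [simp]:
  assumes "a \<in> N" shows "J a \<in> N"
proof (rule nucleusI_left)
  fix x y assume [simp]: "x \<in> C" "y \<in> C"
  have "a \<otimes> ((J a \<otimes> x) \<otimes> y) = a \<otimes> (J a \<otimes> (x \<otimes> y))"
    using assms nuc_left[of a "J a \<otimes> x" y] nuc_left[of a "J a" x] nuc_left[of a "J a" "x \<otimes> y"] by simp
  then show "(J a \<otimes> x) \<otimes> y = J a \<otimes> (x \<otimes> y)" using assms by simp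
qed (use assms in auto)

lemma nuc_cancel [simp]:
  assumes "a \<in> N" "x \<in> C"
  shows "a \<otimes> (J a \<otimes> x) = x" "J a \<otimes> (a \<otimes> x) = x" "(x \<otimes> a) \<otimes> J a = x" "(x \<otimes> J a) \<otimes> a = x"
proof -
  have "a \<otimes> J a = \<one>" "J a \<otimes> a = \<one>" "a \<in> C" "J a \<in> C"
    using assms by auto
  then show "a \<otimes> (J a \<otimes> x) = x" "J a \<otimes> (a \<otimes> x) = x"
      "(x \<otimes> a) \<otimes> J a = x" "(x \<otimes> J a) \<otimes> a = x"
    using assms nuc_left[of a "J a" x] nuc_left[of "J a" a x] nuc_mid[of a x "J a"] nuc_right[of a x "J a"]
    by (simp_all add: nuc_right)
qed

text \<open>The conjugate of the autotopism \<open>(L\<^bsub>a\<^esub>, 1, L\<^bsub>a\<^esub>)\<close> by that of \<open>x\<close> again has trivial second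
  component.\<close>

lemma nuc_conj_right:
  assumes a: "a \<in> N" and [simp]: "x \<in> C"
  shows "x \<setminus> (a \<otimes> x) \<in> N"
proof (rule nucleusI_left)
  define b where "b = x \<setminus> (a \<otimes> x)"
  have [simp]: "a \<in> C" "b \<in> C" using a by (auto simp: b_def)
  have key: "x \<otimes> (((x \<setminus> (a \<otimes> (x \<otimes> u))) \<otimes> v) \<oslash> x) = a \<otimes> (x \<otimes> ((u \<otimes> v) \<oslash> x))"
    if [simp]: "u \<in> C" "v \<in> C" for u v
    using a by (simp add: nuc flip: mult_rdiv_distrib)
  have eq: "(x \<setminus> (a \<otimes> (x \<otimes> u))) \<otimes> v = b \<otimes> (u \<otimes> v)" if [simp]: "u \<in> C" "v \<in> C" for u v
  proof -
    have "x \<otimes> (((x \<setminus> (a \<otimes> (x \<otimes> u))) \<otimes> v) \<oslash> x) = x \<otimes> ((b \<otimes> (u \<otimes> v)) \<oslash> x)"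
      using key[of u v] key[of \<one> "u \<otimes> v"] by (simp add: b_def)
    then show ?thesis
      by simp
  qed
  fix u v assume [simp]: "u \<in> C" "v \<in> C"
  show "(x \<setminus> (a \<otimes> x)) \<otimes> u \<otimes> v = x \<setminus> (a \<otimes> x) \<otimes> (u \<otimes> v)"
    using eq[of u v] eq[of u \<one>] by (simp add: b_def)
qed (use assms in auto)

subsection \<open>The elements \<open>x (1 / x)\<close> are nuclear\<close>

lemma mult_linv_right:
  assumes "x \<in> C" "u \<in> C"
  shows "(x \<otimes> u) \<otimes> J x = x \<otimes> (u \<oslash> x)"
  using mult_rdiv_distrib[of x u \<one>] assms by simp

lemma assoc_map_linv_aut:
  assumes [simp]: "x \<in> C"
  shows "automorphism (assoc_map (J x) x)"
  by (rule assoc_map_aut_if_nuclear_companion) (auto simp: companion_def)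

lemma assoc_map_linv_left:
  "\<lbrakk>x \<in> C; u \<in> C\<rbrakk> \<Longrightarrow> assoc_map (J x) x u = J x \<otimes> (x \<otimes> u)"
  by (simp add: assoc_map_def)

lemma assoc_map_linv_right:
  "\<lbrakk>x \<in> C; u \<in> C\<rbrakk> \<Longrightarrow> (assoc_map (J x) x u \<otimes> J x) \<otimes> x = u"
  using assoc_map_right[of "J x" x u] by simp

text \<open>Write \<open>L\<^bsub>x\<^esub>\<close>, \<open>R\<^bsub>x\<^esub>\<close> for the translations, \<open>p = x x\<close>, \<open>J = 1 / x\<close>.
  The maps \<open>\<theta> = L\<^bsub>J\<^esub> L\<^bsub>x\<^esub>\<close> and \<open>\<beta> = assoc_map p J\<close> are automorphisms because their companions are
  trivial, and \<open>assoc_map x x = \<theta> \<beta>\<^sup>-\<^sup>1\<close>, \<open>assoc_map x J = \<theta>\<close>, \<open>L\<^bsub>x\<^esub> L\<^bsub>J\<^esub> = \<beta> R\<^bsub>J\<^esub> R\<^bsub>x\<^esub>\<close>. For \<open>f = x J\<close> this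
  makes \<open>R\<^bsub>f\<^esub>\<^sup>-\<^sup>1 L\<^bsub>f\<^esub>\<close> an automorphism, which forces \<open>f\<close> into the nucleus.\<close>

lemma mult_linv_nuc:
  assumes x [simp]: "x \<in> C"
  shows "x \<otimes> J x \<in> N"
proof -
  define j where "j = J x"
  define p where "p = x \<otimes> x"
  define f where "f = x \<otimes> j"
  define \<theta> where "\<theta> = assoc_map j x"
  define \<beta> where "\<beta> = assoc_map p j"
  define \<alpha> where "\<alpha> = assoc_map x x"
  have [simp]: "j \<in> C" "p \<in> C" "f \<in> C" and jx [simp]: "j \<otimes> x = \<one>"
    by (auto simp: j_def p_def f_def)
  have \<theta>: "automorphism \<theta>"
    unfolding \<theta>_def j_def by (rule assoc_map_linv_aut) simp
  have \<theta>_left: "\<theta> u = j \<otimes> (x \<otimes> u)" and \<theta>_right: "(\<theta> u \<otimes> j) \<otimes> x = u" if "u \<in> C" for u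
    using that assoc_map_linv_right[of x u] assoc_map_linv_left[of x u] by (simp_all add: \<theta>_def j_def)
  have pj: "p \<otimes> j = x"
    using mult_linv_right[of x x] by (simp add: p_def j_def)
  have \<theta>p: "\<theta> p = p"
  proof -
    have "(\<theta> p \<otimes> j) \<otimes> x = (p \<otimes> j) \<otimes> x" using \<theta>_right[of p] pj by (simp add: p_def)
    then show ?thesis using \<theta> by simp
  qed
  have \<theta>x: "\<theta> x = j \<otimes> p" "\<theta> x = J j"
  proof -
    show "\<theta> x = j \<otimes> p" by (simp add: \<theta>_left p_def)
    have "(\<theta> x \<otimes> j) \<otimes> x = \<one> \<otimes> x" using \<theta>_right[of x] by simp
    then have "\<theta> x \<otimes> j = \<one>" using \<theta> by (simp del: left_one)
    then show "\<theta> x = J j" using \<theta> by (intro rdiv_eqI[symmetric]) auto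
  qed
  have \<beta>: "automorphism \<beta>"
    unfolding \<beta>_def
  proof (rule assoc_map_aut_if_nuclear_companion)
    \<comment> \<open>By \<open>pj\<close> the companion is
      \<open>(J j \<oslash> p) \<otimes> x\<close>, and
      \<open>j \<otimes> x = \<one>\<close>.\<close>
    have "J j \<oslash> p = j" using \<theta>x by simp
    then show "companion p j \<in> N" by (simp add: companion_def pj)
  qed auto
  have \<beta>_left: "x \<otimes> \<beta> u = p \<otimes> (j \<otimes> u)" if "u \<in> C" for u
    using mult_assoc_map[of p j u] that by (simp add: \<beta>_def pj)
  have \<beta>x: "\<beta> x = x"
    using \<beta>_left[of x] \<beta> left_cancel[of x "\<beta> x" x] by (simp add: p_def)
  have \<alpha>_left: "p \<otimes> \<alpha> u = x \<otimes> (x \<otimes> u)" and \<alpha>_right: "u \<otimes> p = (\<alpha> u \<otimes> x) \<otimes> x"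
    and \<alpha>_closed [simp]: "\<alpha> u \<in> C" if "u \<in> C" for u
    using that mult_assoc_map[of x x u] assoc_map_right[of x x u] by (auto simp: \<alpha>_def p_def)
  have \<alpha>\<beta>: "\<alpha> (\<beta> u) = \<theta> u" if [simp]: "u \<in> C" for u
  proof -
    \<comment> \<open>Because \<open>\<beta>\<close> fixes \<open>x\<close>, the factor
      \<open>x\<close> can be pulled inside \<open>\<beta>\<close>, where
      \<open>\<beta>_left\<close> applies.\<close>
    have "p \<otimes> \<alpha> (\<beta> u) = x \<otimes> \<beta> (x \<otimes> u)"
      using \<beta> \<beta>x by (simp add: \<alpha>_left aut_mult)
    also have "\<dots> = p \<otimes> \<theta> u" by (simp add: \<beta>_left \<theta>_left)
    finally show ?thesis using \<beta> \<theta> by simp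
  qed
  have \<alpha>: "automorphism \<alpha>"
    unfolding automorphism_def
  proof (intro conjI ballI)
    show "bij_betw \<alpha> C C" unfolding \<alpha>_def by (rule assoc_map_bij) auto
    fix u v assume "u \<in> C" "v \<in> C"
    then obtain u' v' where [simp]: "u' \<in> C" "v' \<in> C" and uv: "u = \<beta> u'" "v = \<beta> v'"
      using aut_surj[OF \<beta>] by blast
    have "\<alpha> (u \<otimes> v) = \<alpha> (\<beta> (u' \<otimes> v'))" using \<beta> by (simp add: aut_mult uv)
    also have "\<dots> = \<alpha> u \<otimes> \<alpha> v" using \<theta> by (simp add: \<alpha>\<beta> aut_mult uv)
    finally show "\<alpha> (u \<otimes> v) = \<alpha> u \<otimes> \<alpha> v" .
  qed
  have \<alpha>x: "\<alpha> x = \<theta> x" using \<alpha>\<beta>[of x] \<beta>x by simp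
  have \<theta>\<alpha>: "\<theta> (\<alpha> u) = \<alpha> (\<theta> u)" if [simp]: "u \<in> C" for u
  proof -
    obtain v where [simp]: "v \<in> C" and v: "\<theta> u = \<alpha> v"
      using aut_surj[OF \<alpha>, of "\<theta> u"] \<theta> by auto
    \<comment> \<open>Conjugating \<open>\<alpha>\<close> by an automorphism only moves its
      parameter \<open>x\<close>. As \<open>\<theta>\<close> and \<open>\<alpha>\<close> agree at
      \<open>x\<close>, conjugation by \<open>\<theta>\<close> does the same to
      \<open>\<alpha>\<close> as conjugation by \<open>\<alpha>\<close> itself, namely
      nothing.\<close>
    have "\<theta> (\<alpha> u) = assoc_map (\<theta> x) (\<theta> x) (\<theta> u)"
      unfolding \<alpha>_def using \<theta> by (simp add: aut_assoc_map)
    also have "\<dots> = \<alpha> (\<alpha> v)"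
      using aut_assoc_map[OF \<alpha>, of x x v] by (simp add: v \<alpha>x) (simp add: \<alpha>_def)
    finally show ?thesis by (simp add: v)
  qed
  have x\<alpha>: "x \<otimes> \<alpha> u = ((x \<otimes> u) \<otimes> x) \<otimes> j" if [simp]: "u \<in> C" for u
    using assoc_map_rotate[of x x u] mult_linv_right[of x "\<alpha> u \<otimes> x"]
    by (simp add: \<alpha>_def j_def)
  have \<beta>j: "\<beta> j = j"
    unfolding j_def using \<beta> by (simp add: aut_rdiv aut_one \<beta>x)
  have \<beta>f: "\<beta> f = f"
    unfolding f_def using \<beta> by (simp add: aut_mult \<beta>x \<beta>j)
  have xj: "x \<otimes> (j \<otimes> w) = \<beta> ((w \<otimes> x) \<otimes> j)" if [simp]: "w \<in> C" for w
  proof -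
    define v where "v = x \<setminus> w"
    have [simp]: "v \<in> C" and w: "w = x \<otimes> v" by (auto simp: v_def)
    have "x \<otimes> (j \<otimes> w) = x \<otimes> \<alpha> (\<beta> v)" by (simp add: \<alpha>\<beta> \<theta>_left w)
    also have "\<dots> = \<beta> ((w \<otimes> x) \<otimes> j)" using \<beta> by (simp add: x\<alpha> w aut_mult \<beta>x \<beta>j)
    finally show ?thesis .
  qed
  have xj_\<theta>: "assoc_map x j z = \<theta> z" if [simp]: "z \<in> C" for z
  proof -
    define a where "a = assoc_map x j z"
    have [simp]: "a \<in> C" by (simp add: a_def)
    obtain x' where [simp]: "x' \<in> C" and x': "x = \<theta> x'" using aut_surj[OF \<theta>] x by blast
    have "\<theta> (\<alpha> x') = \<theta> x" by (simp add: \<theta>\<alpha> \<alpha>x flip: x')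
    then have \<alpha>x': "\<alpha> x' = x" using aut_inj[OF \<theta>] by simp
    \<comment> \<open>Both \<open>\<theta>\<close> and \<open>\<alpha>\<close> send
      \<open>x'\<close> to \<open>x\<close>, so this \<open>v\<close> links \<open>a\<close> and
      \<open>z\<close> twice: \<open>\<theta> v\<close> yields
      \<open>x \<otimes> v = a \<otimes> x\<close>, and \<open>\<alpha> v\<close> yields
      \<open>x \<otimes> \<alpha> v = z \<otimes> x\<close>.\<close>
    define v where "v = (x \<setminus> z) \<otimes> x'"
    have [simp]: "v \<in> C" by (simp add: v_def)
    have "\<theta> v = (j \<otimes> z) \<otimes> x"
      unfolding v_def using \<theta> by (simp add: aut_mult \<theta>_left[of "x \<setminus> z"] flip: x')
    also have "\<dots> = \<theta> (x \<setminus> (a \<otimes> x))"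
      using assoc_map_rotate[of x j z] by (simp add: \<theta>_left a_def)
    finally have "v = x \<setminus> (a \<otimes> x)" using aut_inj[OF \<theta>] by simp
    then have xv: "x \<otimes> v = a \<otimes> x" by simp
    have "x \<otimes> \<alpha> v = z \<otimes> x"
      using assoc_map_rotate[of x x "x \<setminus> z"] \<alpha>
      by (simp add: v_def aut_mult \<alpha>x') (simp add: \<alpha>_def)
    then have "((a \<otimes> x) \<otimes> x) \<otimes> j = z \<otimes> x"
      using x\<alpha>[of v] by (simp add: xv)
    then have "(((a \<otimes> x) \<otimes> x) \<otimes> j) \<otimes> x = (\<theta> ((z \<otimes> x) \<otimes> x) \<otimes> j) \<otimes> x"
      by (simp add: \<theta>_right)
    then have eq: "(a \<otimes> x) \<otimes> x = \<theta> ((z \<otimes> x) \<otimes> x)"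
      using \<theta> by simp
    obtain z' a' where [simp]: "z' \<in> C" "a' \<in> C" and z': "z = \<alpha> z'" and a': "a = \<alpha> a'"
      using aut_surj[OF \<alpha>] \<open>z \<in> C\<close> \<open>a \<in> C\<close> by blast
    have "a' \<otimes> p = \<theta> z' \<otimes> p"
      using eq \<theta> by (simp add: a' z' aut_mult \<theta>p flip: \<alpha>_right)
    then have "a' = \<theta> z'" using \<theta> by simp
    then have "a = \<theta> z" by (simp add: a' z' \<theta>\<alpha>)
    then show ?thesis by (simp add: a_def)
  qed
  have f\<theta>: "f \<otimes> \<theta> (\<theta> w) = \<beta> w \<otimes> f" if [simp]: "w \<in> C" for w
  proof -
    have "f \<otimes> \<theta> (\<theta> w) = x \<otimes> (j \<otimes> \<theta> w)"
      using mult_assoc_map[of x j "\<theta> w"] \<theta> by (simp add: xj_\<theta> f_def)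
    also have "\<dots> = \<beta> ((\<theta> w \<otimes> x) \<otimes> j)" using \<theta> by (simp add: xj)
    also have "(\<theta> w \<otimes> x) \<otimes> j = w \<otimes> f"
      using assoc_map_right[of x j w] by (simp add: xj_\<theta> f_def)
    finally show ?thesis using \<beta> by (simp add: aut_mult \<beta>f)
  qed
  have \<theta>\<theta>: "\<exists>w\<in>C. u = \<theta> (\<theta> w)" if "u \<in> C" for u
    using aut_surj[OF \<theta>] that by metis
  have \<theta>\<theta>f: "\<theta> (\<theta> f) = f" using f\<theta>[of f] \<theta> by (simp add: \<beta>f)
  \<comment> \<open>By \<open>f\<theta>\<close>, factors pass across \<open>f\<close> up to
    \<open>\<beta>\<close> and the square of \<open>\<theta>\<close>, automorphisms that fix
    \<open>f\<close>. This converts the law at \<open>f\<close> into associativity with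
    \<open>f\<close> in the middle.\<close>
  have "f \<in> N"
  proof (rule nucleusI_mid)
    fix y z assume [simp]: "y \<in> C" "z \<in> C"
    obtain u v where [simp]: "u \<in> C" "v \<in> C" and y: "y = \<beta> u" and z: "z = \<theta> (\<theta> v)"
      using aut_surj[OF \<beta> \<open>y \<in> C\<close>] \<theta>\<theta>[OF \<open>z \<in> C\<close>] by auto
    obtain s where [simp]: "s \<in> C" and s: "(\<theta> (\<theta> u) \<otimes> (z \<otimes> f)) \<oslash> f = \<theta> (\<theta> s)"
      using \<theta>\<theta>[of "(\<theta> (\<theta> u) \<otimes> (z \<otimes> f)) \<oslash> f"] \<theta> by auto
    have "\<theta> (\<theta> (u \<otimes> (v \<otimes> f))) = \<theta> (\<theta> u) \<otimes> (z \<otimes> f)"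
      using \<theta> by (simp add: aut_mult \<theta>\<theta>f z)
    also have "\<dots> = \<theta> (\<theta> s) \<otimes> f"
      using \<theta> by (simp flip: s)
    also have "\<dots> = \<theta> (\<theta> (s \<otimes> f))"
      using \<theta> by (simp add: aut_mult \<theta>\<theta>f)
    finally have "u \<otimes> (v \<otimes> f) = s \<otimes> f"
      using aut_inj[OF \<theta>] \<theta> by simp
    then have "\<beta> (u \<otimes> (v \<otimes> f)) = \<beta> (s \<otimes> f)" by simp
    then have us: "y \<otimes> (\<beta> v \<otimes> f) = \<beta> s \<otimes> f"
      using \<beta> by (simp add: aut_mult \<beta>f y)
    have "(y \<otimes> f) \<otimes> z = (f \<otimes> \<theta> (\<theta> u)) \<otimes> ((z \<otimes> f) \<oslash> f)"
      by (simp add: f\<theta> y)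
    also have "\<dots> = f \<otimes> \<theta> (\<theta> s)"
      using mult_rdiv_distrib[of f "\<theta> (\<theta> u)" "z \<otimes> f"] \<theta> by (simp add: s)
    also have "\<dots> = y \<otimes> (f \<otimes> z)" by (simp add: f\<theta> us z)
    finally show "(y \<otimes> f) \<otimes> z = y \<otimes> (f \<otimes> z)" .
  qed simp
  then show ?thesis by (simp add: f_def j_def)
qed

subsection \<open>Commutativity modulo the nucleus\<close>

text \<open>The left inverse of \<open>I x\<close> is \<open>x\<close>. For
  \<open>n = I (I x) \<otimes> I x\<close>, nuclear by \<open>mult_linv_nuc\<close>, the element
  \<open>J n \<otimes> I (I x)\<close> is a left inverse of \<open>I x\<close> too.\<close>

lemma I_I_nuc:
  assumes [simp]: "x \<in> C"
  shows "I (I x) \<otimes> I x \<in> N" "I (I x) = (I (I x) \<otimes> I x) \<otimes> x"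
proof -
  define n where "n = I (I x) \<otimes> I x"
  have "J (I (I x)) = I x" by simp
  then show n: "I (I x) \<otimes> I x \<in> N"
    using mult_linv_nuc[of "I (I x)"] by simp
  then have nN: "n \<in> N" by (simp add: n_def)
  have "(J n \<otimes> I (I x)) \<otimes> I x = x \<otimes> I x"
    using nN by (simp add: nuc_left) (simp flip: n_def)
  then have "J n \<otimes> I (I x) = x" using nN by (subst (asm) right_cancel) auto
  then have "n \<otimes> (J n \<otimes> I (I x)) = n \<otimes> x" by simp
  then have "I (I x) = n \<otimes> x" using nN by simp
  then show "I (I x) = (I (I x) \<otimes> I x) \<otimes> x" unfolding n_def .
qed

text \<open>Since \<open>X = I (I x)\<close> is a nuclear multiple \<open>n \<otimes> x\<close> of
  \<open>x\<close>, one has \<open>(X \<otimes> y) \<otimes> I (x \<otimes> y) = n\<close>, and the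
  law at \<open>X\<close> moves \<open>X\<close> round to the right end.\<close>

lemma doubly_weak_inverse:
  assumes [simp]: "x \<in> C" "y \<in> C"
  shows "I (x \<otimes> y) \<otimes> I (I x) = I y"
proof -
  define X where "X = I (I x)"
  define n where "n = X \<otimes> I x"
  define z where "z = I (x \<otimes> y)"
  have n: "n \<in> N" and X: "X = n \<otimes> x" using I_I_nuc[of x] by (auto simp: n_def X_def)
  have [simp]: "X \<in> C" "z \<in> C" by (auto simp: X_def z_def)
  have "(X \<otimes> y) \<otimes> z = n" using n by (simp add: X nuc z_def)
  then have "I x = (y \<otimes> (z \<otimes> X)) \<oslash> X"
    using buchsteiner[of X y z] by (simp add: n_def)
  then have "I x \<otimes> X = y \<otimes> (z \<otimes> X)" by simp
  then have "y \<otimes> (z \<otimes> X) = \<one>" by (simp add: X_def)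
  then show ?thesis unfolding X_def z_def by (intro ldiv_eqI[symmetric]) auto
qed

text \<open>The image of the autotopism of \<open>J (J e)\<close> under the action of the doubly weak inverse
  property on autotopisms; it is an isomorphism onto the isotope \<open>(u / e) v\<close>.\<close>

lemma isotope_isomorphism:
  assumes [simp]: "e \<in> C"
  shows "\<exists>M. (\<forall>u\<in>C. M u \<in> C) \<and> (\<forall>w\<in>C. \<exists>u\<in>C. w = M u) \<and>
    (\<forall>u\<in>C. \<forall>v\<in>C. (M u \<oslash> e) \<otimes> M v = M (u \<otimes> v))"
proof -
  \<comment> \<open>Chosen so that \<open>M \<one> = I (I x) = e\<close>.\<close>
  define x where "x = J (J e)"
  have [simp]: "x \<in> C" and e: "e = I (I x)" by (auto simp: x_def)
  define M where "M = (\<lambda>v. I (I (x \<otimes> J (J v))))"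
  have M_closed [simp]: "M v \<in> C" if "v \<in> C" for v using that by (simp add: M_def)
  have M1: "M \<one> = e" by (simp add: M_def e)
  define k where "k = I (x \<otimes> J x)"
  have k: "k \<in> N" using mult_linv_nuc[of x] by (simp add: k_def nuc_I_eq_J)
  have *: "I (x \<otimes> (J u \<oslash> x)) \<otimes> M v = I (J (u \<otimes> v) \<oslash> x)" if [simp]: "u \<in> C" "v \<in> C" for u v
  proof -
    \<comment> \<open>Here \<open>a \<otimes> b = J u\<close> and \<open>v = I (I a)\<close>. The
      doubly weak inverse property for \<open>a, b\<close> gives \<open>u \<otimes> v = I b\<close>;
      for \<open>x \<otimes> a\<close> and \<open>b \<oslash> x\<close> it gives the claim.\<close>
    define a b where "a = J (J v)" and "b = a \<setminus> J u"
    have [simp]: "a \<in> C" "b \<in> C" by (auto simp: a_def b_def)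
    have ab: "a \<otimes> b = J u" by (simp add: b_def)
    have "u \<otimes> v = I b" using doubly_weak_inverse[of a b] by (simp add: ab) (simp add: a_def)
    then have b: "b = J (u \<otimes> v)" by simp
    have "I (x \<otimes> (J u \<oslash> x)) \<otimes> I (I (x \<otimes> a)) = I (b \<oslash> x)"
      using doubly_weak_inverse[of "x \<otimes> a" "b \<oslash> x"] by (simp add: mult_rdiv_distrib ab)
    then show ?thesis by (simp add: M_def a_def b)
  qed
  \<comment> \<open>Setting \<open>u = \<one>\<close> in the previous identity computes its right
    side, up to the nuclear factor \<open>k\<close>.\<close>
  have **: "I (x \<otimes> (J u \<oslash> x)) \<otimes> M v = k \<otimes> M (u \<otimes> v)" if [simp]: "u \<in> C" "v \<in> C" for u v
    using *[of u v] *[of \<one> "u \<otimes> v"] by (simp add: k_def)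
  have eq: "I (x \<otimes> (J u \<oslash> x)) = k \<otimes> (M u \<oslash> e)" if [simp]: "u \<in> C" for u
  proof -
    have "I (x \<otimes> (J u \<oslash> x)) \<otimes> e = (k \<otimes> (M u \<oslash> e)) \<otimes> e"
      using **[of u \<one>] k by (simp add: M1 nuc)
    then show ?thesis using k by simp
  qed
  have "(M u \<oslash> e) \<otimes> M v = M (u \<otimes> v)" if [simp]: "u \<in> C" "v \<in> C" for u v
    using **[of u v] k by (simp add: eq nuc_left)
  moreover have "\<exists>u\<in>C. w = M u" if [simp]: "w \<in> C" for w
    by (rule bexI[of _ "I (I (x \<setminus> J (J w)))"]) (auto simp: M_def)
  ultimately show ?thesis by (intro exI[of _ M]) auto
qed

text \<open>The isotope \<open>(u \<oslash> e) \<otimes> v\<close> is isomorphic to \<open>Q\<close>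
  and so obeys the law. Its law at \<open>t \<otimes> e\<close>, played against those of
  \<open>Q\<close> at \<open>e\<close> and \<open>e \<otimes> t\<close>, yields a map commuting with
  all left translations, that is, a right translation by a nuclear element.\<close>

lemma commutes_mod_nuc:
  assumes [simp]: "e \<in> C" "t \<in> C"
  shows "\<exists>n\<in>N. e \<otimes> t = (t \<otimes> e) \<otimes> n"
proof -
  obtain M where M_closed [simp]: "\<And>u. u \<in> C \<Longrightarrow> M u \<in> C"
    and M_surj: "\<And>w. w \<in> C \<Longrightarrow> \<exists>u\<in>C. w = M u"
    and M: "\<And>u v. \<lbrakk>u \<in> C; v \<in> C\<rbrakk> \<Longrightarrow> (M u \<oslash> e) \<otimes> M v = M (u \<otimes> v)"
    using isotope_isomorphism[OF assms(1)] by blast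
  define w y where "w = t \<otimes> e" and "y = e \<otimes> t"
  have [simp]: "w \<in> C" "y \<in> C" by (auto simp: w_def y_def)
  have we: "w \<oslash> e = t" by (simp add: w_def)
  obtain z where [simp]: "z \<in> C" and z: "w = M z" using M_surj[of w] by auto
  have M_div: "M (v \<oslash> z) = (M v \<oslash> w) \<otimes> e" if [simp]: "v \<in> C" for v
  proof -
    have "(M (v \<oslash> z) \<oslash> e) \<otimes> w = M v" using M[of "v \<oslash> z" z] by (simp add: z)
    then have "M (v \<oslash> z) \<oslash> e = M v \<oslash> w" by (intro rdiv_eqI[symmetric]) auto
    then show ?thesis using rdiv_mult[of e "M (v \<oslash> z)"] by simp
  qed
  \<comment> \<open>The law of the isotope at \<open>w\<close>: there left multiplication by
    \<open>w\<close> is that by \<open>t\<close>, and right division by \<open>w\<close> sends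
    \<open>V\<close> to \<open>(V \<oslash> w) \<otimes> e\<close>.\<close>
  have 1: "(e \<setminus> (y \<otimes> U)) \<otimes> ((V \<oslash> w) \<otimes> e) = t \<otimes> (((U \<otimes> V) \<oslash> w) \<otimes> e)"
    if [simp]: "U \<in> C" "V \<in> C" for U V
  proof -
    obtain u v where [simp]: "u \<in> C" "v \<in> C" and u: "U \<otimes> e = M u" and v: "V = M v"
      using M_surj[of "U \<otimes> e"] M_surj[of V] by auto
    have U: "M u \<oslash> e = U" by (simp flip: u)
    have "(e \<setminus> (y \<otimes> U)) \<otimes> ((V \<oslash> w) \<otimes> e) = ((t \<otimes> M u) \<oslash> e) \<otimes> M (v \<oslash> z)"
      using buchsteiner[of e t U] by (simp add: y_def u v M_div)
    also have "t \<otimes> M u = M (z \<otimes> u)" using M[of z u] by (simp add: we flip: z)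
    also have "(M (z \<otimes> u) \<oslash> e) \<otimes> M (v \<oslash> z) = M (z \<otimes> ((u \<otimes> v) \<oslash> z))"
      by (simp add: M mult_rdiv_distrib)
    also have "\<dots> = t \<otimes> M ((u \<otimes> v) \<oslash> z)"
      using M[of z "(u \<otimes> v) \<oslash> z"] by (simp add: we flip: z)
    also have "\<dots> = t \<otimes> (((U \<otimes> V) \<oslash> w) \<otimes> e)"
      using M[of u v] by (simp add: M_div U v)
    finally show ?thesis .
  qed
  have 2: "e \<otimes> (((e \<setminus> (y \<otimes> U)) \<otimes> ((V \<oslash> y) \<otimes> e)) \<oslash> e) = y \<otimes> ((U \<otimes> V) \<oslash> y)"
    if [simp]: "U \<in> C" "V \<in> C" for U V
    using mult_rdiv_distrib[of e "e \<setminus> (y \<otimes> U)" "(V \<oslash> y) \<otimes> e"] mult_rdiv_distrib[of y U V] by simp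
  \<comment> \<open>By the two identities \<open>W\<close> commutes with left translations. It maps
    \<open>w\<close> to \<open>y\<close>, so \<open>W \<one>\<close> is the factor sought.\<close>
  define W where "W = (\<lambda>V. (V \<oslash> w) \<otimes> y)"
  have [simp]: "W V \<in> C" if "V \<in> C" for V using that by (simp add: W_def)
  have W: "U \<otimes> W V = W (U \<otimes> V)" if [simp]: "U \<in> C" "V \<in> C" for U V
  proof -
    have "y \<otimes> ((U \<otimes> W V) \<oslash> y) = e \<otimes> ((t \<otimes> (((U \<otimes> V) \<oslash> w) \<otimes> e)) \<oslash> e)"
      using 2[of U "W V"] 1[of U V] by (simp add: W_def)
    also have "\<dots> = y \<otimes> (W (U \<otimes> V) \<oslash> y)"
      using 2[of \<one> "W (U \<otimes> V)"] 1[of \<one> "U \<otimes> V"] by (simp add: W_def)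
    finally show ?thesis by simp
  qed
  have W1: "W V = V \<otimes> W \<one>" if "V \<in> C" for V using W[of V \<one>] that by simp
  have "W \<one> \<in> N"
  proof (rule nucleusI_right)
    fix x y assume [simp]: "x \<in> C" "y \<in> C"
    show "(x \<otimes> y) \<otimes> W \<one> = x \<otimes> (y \<otimes> W \<one>)" using W[of x y] by (simp flip: W1)
  qed simp
  moreover have "y = w \<otimes> W \<one>" using W1[of w] by (simp add: W_def)
  ultimately show ?thesis by (auto simp: y_def w_def)
qed

subsection \<open>Congruence modulo the nucleus and associators\<close>

definition cong_nuc (infix "\<sim>" 50) where
  "x \<sim> y \<longleftrightarrow> (\<exists>n\<in>N. y = x \<otimes> n)"

definition act (infixl "\<star>" 75) where
  "a \<star> x = x \<setminus> (a \<otimes> x)"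

lemma act_nuc [simp]: "\<lbrakk>a \<in> N; x \<in> C\<rbrakk> \<Longrightarrow> a \<star> x \<in> N"
  unfolding act_def by (rule nuc_conj_right)

lemma nuc_swap: "\<lbrakk>a \<in> N; x \<in> C\<rbrakk> \<Longrightarrow> a \<otimes> x = x \<otimes> (a \<star> x)"
  unfolding act_def by simp

lemma act_eqI: "\<lbrakk>a \<in> N; x \<in> C; b \<in> C; a \<otimes> x = x \<otimes> b\<rbrakk> \<Longrightarrow> a \<star> x = b"
  unfolding act_def by simp

lemma act_one [simp]: "a \<in> N \<Longrightarrow> a \<star> \<one> = a"
  by (rule act_eqI) auto

lemma one_act [simp]: "x \<in> C \<Longrightarrow> \<one> \<star> x = \<one>"
  by (rule act_eqI) auto

lemma act_mult:
  assumes [simp]: "a \<in> N" "b \<in> N" "x \<in> C"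
  shows "(a \<otimes> b) \<star> x = (a \<star> x) \<otimes> (b \<star> x)"
proof (rule act_eqI)
  have "(a \<otimes> b) \<otimes> x = a \<otimes> (x \<otimes> (b \<star> x))" by (simp add: nuc_left nuc_swap[of b x])
  also have "\<dots> = (a \<otimes> x) \<otimes> (b \<star> x)" by (simp add: nuc_left)
  also have "\<dots> = x \<otimes> ((a \<star> x) \<otimes> (b \<star> x))" by (simp add: nuc_swap[of a x] nuc_right)
  finally show "(a \<otimes> b) \<otimes> x = x \<otimes> ((a \<star> x) \<otimes> (b \<star> x))" .
qed auto

lemma act_act:
  assumes [simp]: "a \<in> N" "x \<in> C" "y \<in> C"
  shows "a \<star> (x \<otimes> y) = (a \<star> x) \<star> y"
proof (rule act_eqI)
  have "a \<otimes> (x \<otimes> y) = (x \<otimes> (a \<star> x)) \<otimes> y" 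
    using nuc_left[of a x y] nuc_swap[of a x] by simp
  also have "\<dots> = x \<otimes> (y \<otimes> ((a \<star> x) \<star> y))" by (simp add: nuc_mid nuc_swap[of "a \<star> x" y])
  finally show "a \<otimes> (x \<otimes> y) = (x \<otimes> y) \<otimes> ((a \<star> x) \<star> y)" by (simp add: nuc_right)
qed auto

lemma act_inj [simp]: "\<lbrakk>a \<in> N; b \<in> N; x \<in> C\<rbrakk> \<Longrightarrow> a \<star> x = b \<star> x \<longleftrightarrow> a = b"
  unfolding act_def by simp

lemma act_inv:
  assumes [simp]: "a \<in> N" "x \<in> C"
  shows "J a \<star> x = J (a \<star> x)"
proof -
  have "(J a \<star> x) \<otimes> (a \<star> x) = \<one>" by (simp add: act_mult[symmetric])
  then show ?thesis by (intro rdiv_eqI[symmetric]) auto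
qed

lemma act_linv: "\<lbrakk>a \<in> N; x \<in> C\<rbrakk> \<Longrightarrow> (a \<star> J x) \<star> x = a"
  by (simp add: act_act[symmetric])

lemma nuc_swap_left: "\<lbrakk>a \<in> N; x \<in> C\<rbrakk> \<Longrightarrow> x \<otimes> a = (a \<star> J x) \<otimes> x"
  by (simp add: nuc_swap[of "a \<star> J x" x] act_linv)

lemma cong_sym:
  assumes "x \<in> C" "x \<sim> y" shows "y \<sim> x"
proof -
  obtain n where "n \<in> N" "y = x \<otimes> n" using assms by (auto simp: cong_nuc_def)
  then show ?thesis using assms unfolding cong_nuc_def by (intro bexI[of _ "J n"]) auto
qed

lemma cong_trans:
  assumes "x \<in> C" "x \<sim> y" "y \<sim> z" shows "x \<sim> z"
proof -
  obtain m n where "m \<in> N" "y = x \<otimes> m" "n \<in> N" "z = y \<otimes> n"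
    using assms by (auto simp: cong_nuc_def)
  then show ?thesis using assms unfolding cong_nuc_def
    by (intro bexI[of _ "m \<otimes> n"]) (auto simp: nuc_right)
qed

lemma cong_left:
  assumes "x \<in> C" "z \<in> C" "x \<sim> y" shows "z \<otimes> x \<sim> z \<otimes> y"
  using assms unfolding cong_nuc_def by (auto simp: nuc_right)

lemma cong_right:
  assumes "x \<in> C" "z \<in> C" "x \<sim> y" shows "x \<otimes> z \<sim> y \<otimes> z"
proof -
  obtain n where n: "n \<in> N" "y = x \<otimes> n" using assms by (auto simp: cong_nuc_def)
  then have "y \<otimes> z = (x \<otimes> z) \<otimes> (n \<star> z)"
    using assms by (simp add: nuc_mid nuc_right nuc_swap[of n z])
  then show ?thesis using n assms unfolding cong_nuc_def by (intro bexI[of _ "n \<star> z"]) auto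
qed

lemma cong_commute: "\<lbrakk>x \<in> C; y \<in> C\<rbrakk> \<Longrightarrow> x \<otimes> y \<sim> y \<otimes> x"
  unfolding cong_nuc_def by (rule commutes_mod_nuc)

text \<open>The element \<open>s\<close> with
  \<open>y \<otimes> s = (y \<otimes> x) \<otimes> z\<close> satisfies
  \<open>s \<otimes> y = x \<otimes> (z \<otimes> y)\<close> by the law, so commutativity modulo
  \<open>N\<close> implies associativity modulo \<open>N\<close>.\<close>

lemma cong_assoc:
  assumes [simp]: "x \<in> C" "y \<in> C" "z \<in> C"
  shows "x \<otimes> (y \<otimes> z) \<sim> (x \<otimes> y) \<otimes> z"
proof -
  define s where "s = y \<setminus> ((y \<otimes> x) \<otimes> z)"
  have [simp]: "s \<in> C" by (simp add: s_def)
  have ys: "y \<otimes> s = (y \<otimes> x) \<otimes> z" by (simp add: s_def)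
  have sy: "s \<otimes> y = x \<otimes> (z \<otimes> y)" using buchsteiner[of y x z] by (simp add: s_def)
  have "x \<otimes> (y \<otimes> z) \<sim> x \<otimes> (z \<otimes> y)" by (simp add: cong_left cong_commute)
  moreover have "x \<otimes> (z \<otimes> y) \<sim> (y \<otimes> x) \<otimes> z" using cong_commute[of s y] by (simp add: sy ys)
  moreover have "(y \<otimes> x) \<otimes> z \<sim> (x \<otimes> y) \<otimes> z" by (simp add: cong_right cong_commute)
  ultimately show ?thesis by (meson assms cong_trans mult_closed)
qed

lemma cong_one_iff: "x \<in> C \<Longrightarrow> \<one> \<sim> x \<longleftrightarrow> x \<in> N"
  unfolding cong_nuc_def by auto

text \<open>Modulo \<open>N\<close> the companion reassociates to
  \<open>((J y \<oslash> x) \<otimes> x) \<otimes> y = \<one>\<close>, hence it is nuclear.\<close>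

lemma assoc_map_aut:
  assumes [simp]: "x \<in> C" "y \<in> C"
  shows "automorphism (assoc_map x y)"
proof (rule assoc_map_aut_if_nuclear_companion)
  have "companion x y \<sim> \<one>"
    using cong_assoc[of "J y \<oslash> x" x y] by (simp add: companion_def)
  then have "\<one> \<sim> companion x y" by (rule cong_sym[rotated]) simp_all
  then show "companion x y \<in> N" by (simp add: cong_one_iff)
qed auto

section \<open>The centre of the nucleus and the action of \<open>Q/N(Q)\<close> on it\<close>

definition nuc_centre ("V") where
  "V = {a \<in> N. \<forall>b\<in>N. a \<otimes> b = b \<otimes> a}"

lemma V_nuc [simp]: "a \<in> V \<Longrightarrow> a \<in> N"
  unfolding nuc_centre_def by blast

lemma V_carrier [simp]: "a \<in> V \<Longrightarrow> a \<in> C"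
  by simp

lemma V_commute: "\<lbrakk>a \<in> V; b \<in> N\<rbrakk> \<Longrightarrow> a \<otimes> b = b \<otimes> a"
  unfolding nuc_centre_def by blast

lemma V_commute': "\<lbrakk>a \<in> V; b \<in> V\<rbrakk> \<Longrightarrow> a \<otimes> b = b \<otimes> a"
  unfolding nuc_centre_def by blast

lemma V_left_commute: "\<lbrakk>a \<in> V; b \<in> V; c \<in> C\<rbrakk> \<Longrightarrow> a \<otimes> (b \<otimes> c) = b \<otimes> (a \<otimes> c)"
  using V_commute'[of a b] by (simp flip: nuc_left)

lemma V_left_assoc: "\<lbrakk>a \<in> V; x \<in> C; y \<in> C\<rbrakk> \<Longrightarrow> (a \<otimes> x) \<otimes> y = a \<otimes> (x \<otimes> y)"
  by (simp add: nuc_left)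

lemmas V_ac = V_left_assoc V_commute' V_left_commute

lemma one_V [simp]: "\<one> \<in> V"
  unfolding nuc_centre_def by simp

lemma V_mult [simp]:
  assumes [simp]: "a \<in> V" "b \<in> V" shows "a \<otimes> b \<in> V"
  unfolding nuc_centre_def
proof (intro CollectI conjI ballI)
  fix c assume [simp]: "c \<in> N"
  have "(a \<otimes> b) \<otimes> c = (a \<otimes> c) \<otimes> b" by (simp add: nuc_left V_commute[of b c])
  also have "\<dots> = c \<otimes> (a \<otimes> b)" by (simp add: V_commute[of a c] nuc_left)
  finally show "(a \<otimes> b) \<otimes> c = c \<otimes> (a \<otimes> b)" .
qed simp

lemma V_inv [simp]:
  assumes [simp]: "a \<in> V" shows "J a \<in> V"
  unfolding nuc_centre_def
proof (intro CollectI conjI ballI)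
  fix b assume [simp]: "b \<in> N"
  have "a \<otimes> (J a \<otimes> b) = a \<otimes> (b \<otimes> J a)"
    by (subst V_commute[of a "b \<otimes> J a"]) auto
  then show "J a \<otimes> b = b \<otimes> J a" by (subst (asm) left_cancel) auto
qed simp

lemma V_act [simp]:
  assumes [simp]: "a \<in> V" "x \<in> C" shows "a \<star> x \<in> V"
  unfolding nuc_centre_def
proof (intro CollectI conjI ballI)
  fix b assume b [simp]: "b \<in> N"
  have "a \<otimes> (b \<star> J x) = (b \<star> J x) \<otimes> a" by (rule V_commute) auto
  then have "(a \<otimes> (b \<star> J x)) \<star> x = ((b \<star> J x) \<otimes> a) \<star> x" by simp
  then show "a \<star> x \<otimes> b = b \<otimes> a \<star> x" by (simp add: act_mult act_linv)
qed simp

lemma V_inv_mult: "\<lbrakk>a \<in> V; b \<in> V\<rbrakk> \<Longrightarrow> J (a \<otimes> b) = J a \<otimes> J b"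
  by (rule rdiv_eqI) (auto simp: nuc_left V_commute[of a b])

lemma nuc_inv_inv [simp]: "a \<in> N \<Longrightarrow> J (J a) = a"
  by (rule rdiv_eqI) auto

lemma nuc_act_V [simp]: "\<lbrakk>a \<in> V; n \<in> N\<rbrakk> \<Longrightarrow> a \<star> n = a"
  by (rule act_eqI) (auto intro: V_commute)

lemma act_cong: "\<lbrakk>a \<in> V; x \<in> C; x \<sim> y\<rbrakk> \<Longrightarrow> a \<star> x = a \<star> y"
  unfolding cong_nuc_def by (auto simp: act_act)

lemma act_commute: "\<lbrakk>a \<in> V; x \<in> C; y \<in> C\<rbrakk> \<Longrightarrow> a \<star> x \<star> y = a \<star> y \<star> x"
  using act_cong[of a "x \<otimes> y" "y \<otimes> x"] by (simp add: cong_commute act_act)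

section \<open>Associators: crossed homomorphisms in each argument, with values in
  \<open>V\<close>\<close>

definition asc where
  "asc x y z = (x \<otimes> (y \<otimes> z)) \<setminus> ((x \<otimes> y) \<otimes> z)"

lemma mult_asc: "\<lbrakk>x \<in> C; y \<in> C; z \<in> C\<rbrakk> \<Longrightarrow> (x \<otimes> y) \<otimes> z = (x \<otimes> (y \<otimes> z)) \<otimes> asc x y z"
  unfolding asc_def by simp

lemma asc_eqI: "\<lbrakk>x \<in> C; y \<in> C; z \<in> C; a \<in> C; (x \<otimes> y) \<otimes> z = (x \<otimes> (y \<otimes> z)) \<otimes> a\<rbrakk> \<Longrightarrow> asc x y z = a"
  unfolding asc_def by simp

lemma asc_nuc [simp]:
  assumes [simp]: "x \<in> C" "y \<in> C" "z \<in> C" shows "asc x y z \<in> N"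
  using cong_assoc[of x y z] unfolding cong_nuc_def by (auto simp: asc_def)

lemma assoc_map_asc:
  assumes [simp]: "x \<in> C" "y \<in> C" "z \<in> C"
  shows "assoc_map x y z \<otimes> asc x y z = z"
proof -
  have "(x \<otimes> y) \<otimes> (assoc_map x y z \<otimes> asc x y z) = (x \<otimes> y) \<otimes> z"
    using mult_assoc_map[of x y z] mult_asc[of x y z] by (simp add: nuc_right[symmetric])
  then show ?thesis by (subst (asm) left_cancel) auto
qed

lemma asc_nuc_left1:
  "\<lbrakk>n \<in> N; x \<in> C; y \<in> C; z \<in> C\<rbrakk> \<Longrightarrow> asc (n \<otimes> x) y z = asc x y z"
  using mult_asc[of x y z] by (intro asc_eqI) (auto simp: nuc)

lemma asc_nuc_mid1:
  "\<lbrakk>n \<in> N; x \<in> C; y \<in> C; z \<in> C\<rbrakk> \<Longrightarrow> asc (x \<otimes> n) y z = asc x (n \<otimes> y) z"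
  unfolding asc_def by (simp add: nuc_mid nuc_left)

lemma asc_nuc_mid2:
  "\<lbrakk>n \<in> N; x \<in> C; y \<in> C; z \<in> C\<rbrakk> \<Longrightarrow> asc x (y \<otimes> n) z = asc x y (n \<otimes> z)"
  using nuc_mid[of n y z] nuc_right[of n x y] nuc_mid[of n "x \<otimes> y" z] unfolding asc_def by simp

lemma asc_nuc_right:
  assumes [simp]: "n \<in> N" "x \<in> C" "y \<in> C" "z \<in> C"
  shows "n \<otimes> asc x y (z \<otimes> n) = asc x y z \<otimes> n"
proof -
  have eq: "x \<otimes> (y \<otimes> (z \<otimes> n)) = (x \<otimes> (y \<otimes> z)) \<otimes> n"
    using nuc_right[of n y z] nuc_right[of n x "y \<otimes> z"] by simp
  have "(x \<otimes> (y \<otimes> z)) \<otimes> (n \<otimes> asc x y (z \<otimes> n)) = (x \<otimes> y) \<otimes> (z \<otimes> n)"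
    using mult_asc[of x y "z \<otimes> n"] nuc_mid[of n "x \<otimes> (y \<otimes> z)" "asc x y (z \<otimes> n)"]
    unfolding eq by simp
  also have "\<dots> = ((x \<otimes> y) \<otimes> z) \<otimes> n"
    by (simp add: nuc_right)
  also have "\<dots> = (x \<otimes> (y \<otimes> z)) \<otimes> (asc x y z \<otimes> n)"
    unfolding mult_asc[OF assms(2-4)] by (simp add: nuc_right)
  finally show ?thesis by simp
qed

lemma cong_left_factor:
  assumes "x \<in> C" "x \<sim> y"
  shows "\<exists>n\<in>N. y = n \<otimes> x"
proof -
  obtain n where n: "n \<in> N" "y = x \<otimes> n" using assms by (auto simp: cong_nuc_def)
  have "n \<star> J x \<in> N" "y = (n \<star> J x) \<otimes> x" using n assms by (simp_all add: nuc_swap_left)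
  then show ?thesis by (rule bexI[rotated])
qed

lemma asc_cong1: "\<lbrakk>x \<in> C; y \<in> C; z \<in> C; x \<sim> x'\<rbrakk> \<Longrightarrow> asc x' y z = asc x y z"
  using cong_left_factor[of x x'] by (auto simp: asc_nuc_left1)

text \<open>A nuclear left factor of one argument can be handed to the preceding argument as a right
  factor, where it is already known to be harmless.\<close>

lemma asc_cong2:
  assumes "x \<in> C" "y \<in> C" "z \<in> C" "y \<sim> y'" shows "asc x y' z = asc x y z"
proof -
  obtain n where "n \<in> N" "y' = n \<otimes> y" using cong_left_factor assms by blast
  moreover have "x \<sim> x \<otimes> n" using \<open>n \<in> N\<close> by (auto simp: cong_nuc_def)
  ultimately show ?thesis using assms asc_cong1[of x y z "x \<otimes> n"] by (simp add: asc_nuc_mid1)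
qed

lemma asc_cong3:
  assumes "x \<in> C" "y \<in> C" "z \<in> C" "z \<sim> z'" shows "asc x y z' = asc x y z"
proof -
  obtain n where "n \<in> N" "z' = n \<otimes> z" using cong_left_factor assms by blast
  moreover have "y \<sim> y \<otimes> n" using \<open>n \<in> N\<close> by (auto simp: cong_nuc_def)
  ultimately show ?thesis using assms asc_cong2[of x y z "y \<otimes> n"] by (simp add: asc_nuc_mid2)
qed

text \<open>Replacing \<open>z\<close> by \<open>z \<otimes> n\<close> conjugates the associator by
  \<open>n\<close> (\<open>asc_nuc_right\<close>) but leaves it unchanged
  (\<open>asc_cong3\<close>).\<close>

lemma asc_V [simp]:
  assumes [simp]: "x \<in> C" "y \<in> C" "z \<in> C" shows "asc x y z \<in> V"
  unfolding nuc_centre_def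
proof (intro CollectI conjI ballI)
  fix n assume [simp]: "n \<in> N"
  have "z \<sim> z \<otimes> n" by (auto simp: cong_nuc_def)
  then show "asc x y z \<otimes> n = n \<otimes> asc x y z"
    using asc_nuc_right[of n x y z] asc_cong3[of x y z "z \<otimes> n"] by simp
qed simp

text \<open>The automorphism \<open>h = assoc_map x y\<close> moves \<open>u\<close> by the factor
  \<open>asc x y u\<close>. In comparing \<open>h (z \<otimes> w)\<close> with
  \<open>h z \<otimes> h w\<close>, the factor of \<open>z\<close> has to pass \<open>h w\<close>,
  which causes the action.\<close>

lemma asc_mult3:
  assumes [simp]: "x \<in> C" "y \<in> C" "z \<in> C" "w \<in> C"
  shows "asc x y (z \<otimes> w) = (asc x y z \<star> w) \<otimes> asc x y w"
proof -
  define h where "h = assoc_map x y"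
  have h: "automorphism h" unfolding h_def by (rule assoc_map_aut) auto
  have h_asc: "h u \<otimes> asc x y u = u" if "u \<in> C" for u using that by (simp add: h_def assoc_map_asc)
  have [simp]: "h u \<in> C" if "u \<in> C" for u using that h by simp
  have "h w \<sim> w" unfolding cong_nuc_def using h_asc[of w] by (intro bexI[of _ "asc x y w"]) auto
  then have act: "asc x y z \<star> h w = asc x y z \<star> w" by (intro act_cong) auto
  have "(h z \<otimes> h w) \<otimes> ((asc x y z \<star> w) \<otimes> asc x y w)
      = h z \<otimes> ((h w \<otimes> (asc x y z \<star> h w)) \<otimes> asc x y w)"
    by (simp add: nuc_right act)
  also have "\<dots> = h z \<otimes> (asc x y z \<otimes> (h w \<otimes> asc x y w))"
    by (simp add: nuc_left flip: nuc_swap)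
  also have "\<dots> = (h z \<otimes> asc x y z) \<otimes> (h w \<otimes> asc x y w)" by (simp only: nuc_mid[symmetric] assms asc_nuc h mult_closed \<open>\<And>u. u \<in> C \<Longrightarrow> h u \<in> C\<close> nuc_carrier)
  also have "\<dots> = (h z \<otimes> h w) \<otimes> asc x y (z \<otimes> w)"
    using h_asc[of "z \<otimes> w"] h by (simp add: h_asc aut_mult)
  finally show ?thesis by (subst (asm) left_cancel) auto
qed

lemma asc_rotate:
  assumes [simp]: "x \<in> C" "y \<in> C" "z \<in> C"
  shows "asc y z x = J (asc x y z \<star> x)"
proof -
  define h where "h = assoc_map x y z"
  have [simp]: "h \<in> C" by (simp add: h_def)
  have z: "h \<otimes> asc x y z = z" by (simp add: h_def assoc_map_asc)
  have "z \<otimes> x = (h \<otimes> x) \<otimes> (asc x y z \<star> x)"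
    using nuc_swap[of "asc x y z" x] nuc_mid[of "asc x y z" h x] by (simp add: z nuc_right)
  then have "y \<otimes> (z \<otimes> x) = ((y \<otimes> z) \<otimes> x) \<otimes> (asc x y z \<star> x)"
    using assoc_map_rotate[of x y z] by (simp add: nuc_right h_def[symmetric])
  then show ?thesis by (intro asc_eqI) auto
qed

lemma asc_rotate2:
  assumes [simp]: "x \<in> C" "y \<in> C" "z \<in> C"
  shows "asc z x y = asc x y z \<star> x \<star> y"
  by (simp add: asc_rotate[of y z x] asc_rotate[of x y z] act_inv)

text \<open>Each rotation inverts the associator and acts by one argument; three rotations restore
  the triple.\<close>

lemma asc_act_all:
  assumes [simp]: "x \<in> C" "y \<in> C" "z \<in> C"
  shows "asc x y z \<star> x \<star> y \<star> z = J (asc x y z)"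
proof -
  have "J (asc x y z) = J (J (asc x y z \<star> x \<star> y \<star> z))"
    using asc_rotate[of z x y] by (simp only: asc_rotate2[OF assms] assms)
  then show ?thesis by simp
qed

lemma asc_mult2:
  assumes [simp]: "x \<in> C" "y \<in> C" "z \<in> C" "w \<in> C"
  shows "asc x (y \<otimes> w) z = (asc x y z \<star> w) \<otimes> asc x w z"
  by (simp add: asc_rotate[of z x] asc_mult3 act_mult V_inv_mult act_inv act_commute[of _ w z])

lemma asc_mult1:
  assumes [simp]: "x \<in> C" "y \<in> C" "z \<in> C" "w \<in> C"
  shows "asc (x \<otimes> w) y z = (asc x y z \<star> w) \<otimes> asc w y z"
  by (simp add: asc_rotate[of z _ y] asc_mult2 act_mult V_inv_mult act_inv act_commute[of _ w z])

text \<open>Two expansions of \<open>asc z x (y \<otimes> w)\<close> are compared: one in the third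
  argument, the other after rotation to \<open>asc x (y \<otimes> w) z\<close>, with
  \<open>w \<otimes> y\<close> in place of \<open>y \<otimes> w\<close>. The factors from
  \<open>asc x y z\<close> cancel.\<close>

lemma asc_square_act:
  assumes [simp]: "x \<in> C" "w \<in> C" "z \<in> C" "y \<in> C"
  shows "asc x w z \<star> y \<star> y = asc x w z"
proof -
  define f g where "f = asc x y z" and "g = asc x w z"
  have [simp]: "f \<in> V" "g \<in> V" by (auto simp: f_def g_def)
  have "asc x (y \<otimes> w) z = (g \<star> y) \<otimes> f"
    using asc_cong2[of x "y \<otimes> w" z "w \<otimes> y"] by (simp add: cong_commute asc_mult2 f_def g_def)
  then have "asc z x (y \<otimes> w) = (g \<star> y \<star> x \<star> (y \<otimes> w)) \<otimes> (f \<star> x \<star> (y \<otimes> w))"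
    by (simp add: asc_rotate2[of x "y \<otimes> w" z] act_mult)
  moreover have "asc z x (y \<otimes> w) = (f \<star> x \<star> (y \<otimes> w)) \<otimes> (g \<star> x \<star> w)"
    by (simp add: asc_mult3 asc_rotate2[of x _ z] act_act f_def g_def)
  ultimately have "(f \<star> x \<star> (y \<otimes> w)) \<otimes> (g \<star> y \<star> x \<star> (y \<otimes> w)) = (f \<star> x \<star> (y \<otimes> w)) \<otimes> (g \<star> x \<star> w)"
    by (simp add: V_commute'[of "f \<star> x \<star> (y \<otimes> w)"])
  then have "g \<star> y \<star> x \<star> (y \<otimes> w) = g \<star> x \<star> w"
    by (subst (asm) left_cancel) auto
  then have "g \<star> y \<star> y \<star> x \<star> w = g \<star> x \<star> w"
    by (simp add: act_act act_commute[of "g \<star> y" x y])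
  then show ?thesis by (simp add: g_def)
qed

text \<open>The crossed homomorphism rule on both sides of
  \<open>z \<otimes> w \<sim> w \<otimes> z\<close>.\<close>

lemma asc_exchange3:
  "\<lbrakk>x \<in> C; y \<in> C; z \<in> C; w \<in> C\<rbrakk> \<Longrightarrow> (asc x y z \<star> w) \<otimes> asc x y w = (asc x y w \<star> z) \<otimes> asc x y z"
  using asc_cong3[of x y "z \<otimes> w" "w \<otimes> z"] by (simp add: cong_commute asc_mult3)

lemma asc_exchange2:
  "\<lbrakk>x \<in> C; y \<in> C; z \<in> C; w \<in> C\<rbrakk> \<Longrightarrow> (asc x y z \<star> w) \<otimes> asc x w z = (asc x w z \<star> y) \<otimes> asc x y z"
  using asc_cong2[of x "y \<otimes> w" z "w \<otimes> y"] by (simp add: cong_commute asc_mult2)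

lemma asc_exchange1:
  "\<lbrakk>x \<in> C; y \<in> C; z \<in> C; w \<in> C\<rbrakk> \<Longrightarrow> (asc x y z \<star> w) \<otimes> asc w y z = (asc w y z \<star> x) \<otimes> asc x y z"
  using asc_cong1[of "x \<otimes> w" y z "w \<otimes> x"] by (simp add: cong_commute asc_mult1)

end

subsection \<open>Quotients and conjugacy closedness\<close>

context loop
begin

lemma rcos_mem_iff: "v \<in> A #> u \<longleftrightarrow> (\<exists>a\<in>A. v = a \<otimes> u)"
  unfolding r_coset_def by auto

lemma rcos_memI: "a \<in> A \<Longrightarrow> a \<otimes> u \<in> A #> u"
  unfolding rcos_mem_iff by blast

context
  fixes A
  assumes A: "normal_subloop A Q"
begin

lemma normal_sub: "a \<in> A \<Longrightarrow> a \<in> C"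
  using A unfolding normal_subloop_def subloop_def by blast

lemma normal_one: "\<one> \<in> A"
  using A unfolding normal_subloop_def subloop_def by blast

lemma rcos_closed: "\<lbrakk>u \<in> C; v \<in> A #> u\<rbrakk> \<Longrightarrow> v \<in> C"
  using normal_sub by (auto simp: rcos_mem_iff)

lemma rcos_self: "u \<in> C \<Longrightarrow> u \<in> A #> u"
  using rcos_memI[of \<one> A u] normal_one by simp

lemma rcos_assoc: "\<lbrakk>x \<in> C; y \<in> C\<rbrakk> \<Longrightarrow> (A #> x) #> y = A #> (x \<otimes> y)"
  using A unfolding normal_subloop_def by blast

lemma rcos_normal: "a \<in> A \<Longrightarrow> A #> a = A"
proof -
  assume a: "a \<in> A"
  have mult: "b \<otimes> a \<in> A" and div: "b \<oslash> a \<in> A" if "b \<in> A" for b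
    using A a that unfolding normal_subloop_def subloop_def by blast+
  show ?thesis
  proof (intro equalityI subsetI)
    fix b assume "b \<in> A"
    then have "b \<oslash> a \<in> A" "b = (b \<oslash> a) \<otimes> a" using div a normal_sub by auto
    then show "b \<in> A #> a" unfolding rcos_mem_iff by blast
  qed (use mult in \<open>auto simp: rcos_mem_iff\<close>)
qed

lemma rcos_one: "A #> \<one> = A"
  by (rule rcos_normal) (rule normal_one)

lemma rcos_eq: "\<lbrakk>u \<in> C; v \<in> A #> u\<rbrakk> \<Longrightarrow> A #> v = A #> u"
  using rcos_assoc rcos_normal normal_sub unfolding rcos_mem_iff by metis

lemma rcos_eq_iff: "\<lbrakk>u \<in> C; v \<in> C\<rbrakk> \<Longrightarrow> A #> v = A #> u \<longleftrightarrow> v \<in> A #> u"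
  using rcos_eq rcos_self by metis

lemma rcos_mult_closed:
  assumes "x \<in> C" "y \<in> C" "u \<in> A #> y" shows "x \<otimes> u \<in> A #> (x \<otimes> y)"
proof -
  have "u \<in> l_coset Q y A" using A assms unfolding normal_subloop_def by blast
  then have "x \<otimes> u \<in> l_coset Q x (l_coset Q y A)" unfolding l_coset_def by blast
  then show ?thesis using A assms mult_closed unfolding normal_subloop_def by blast
qed

lemma rcos_mult:
  assumes [simp]: "x \<in> C" "y \<in> C"
  shows "(A #> x) <#> (A #> y) = A #> (x \<otimes> y)"
proof (intro equalityI subsetI)
  fix v assume "v \<in> (A #> x) <#> (A #> y)"
  then obtain w u where w: "w \<in> A #> x" and u: "u \<in> A #> y" and v: "v = w \<otimes> u"
    unfolding set_mult_def by blast
  have [simp]: "u \<in> C" using rcos_closed[OF _ u] by simp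
  have "v \<in> (A #> x) #> u" using w v unfolding r_coset_def by blast
  then have "v \<in> A #> (x \<otimes> u)" by (simp add: rcos_assoc)
  then show "v \<in> A #> (x \<otimes> y)"
    using rcos_eq[OF _ rcos_mult_closed[OF assms u]] by simp
next
  fix v assume "v \<in> A #> (x \<otimes> y)"
  then have "v \<in> (A #> x) #> y" by (simp add: rcos_assoc)
  then obtain w where "w \<in> A #> x" "v = w \<otimes> y" unfolding r_coset_def[of _ "A #> x"] by blast
  moreover have "y \<in> A #> y" by (rule rcos_self) simp
  ultimately show "v \<in> (A #> x) <#> (A #> y)" unfolding set_mult_def by blast
qed

lemma Mod_simps:
  "carrier (Q Mod A) = (\<lambda>x. A #> x) ` C" "\<one>\<^bsub>Q Mod A\<^esub> = A"
  "X \<otimes>\<^bsub>Q Mod A\<^esub> Y = X <#> Y"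
  unfolding FactGroup_def RCOSETS_def by auto

lemma Mod_group:
  assumes "\<And>x y z. \<lbrakk>x \<in> C; y \<in> C; z \<in> C\<rbrakk> \<Longrightarrow> (x \<otimes> y) \<otimes> z \<in> A #> (x \<otimes> (y \<otimes> z))"
  shows "group (Q Mod A)"
proof (rule groupI)
  show "\<one>\<^bsub>Q Mod A\<^esub> \<in> carrier (Q Mod A)"
    using rcos_one one_closed by (force simp: Mod_simps)
next
  fix X assume "X \<in> carrier (Q Mod A)"
  then obtain x where x: "x \<in> C" "X = A #> x" by (auto simp: Mod_simps)
  have "(A #> J x) <#> (A #> x) = A" using x by (simp add: rcos_mult rcos_one)
  then show "\<exists>Y\<in>carrier (Q Mod A). Y \<otimes>\<^bsub>Q Mod A\<^esub> X = \<one>\<^bsub>Q Mod A\<^esub>"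
    using x by (force simp: Mod_simps)
  show "\<one>\<^bsub>Q Mod A\<^esub> \<otimes>\<^bsub>Q Mod A\<^esub> X = X"
    using rcos_mult[of \<one> x] x by (simp add: Mod_simps rcos_one)
next
  fix X Y Z assume "X \<in> carrier (Q Mod A)" "Y \<in> carrier (Q Mod A)" "Z \<in> carrier (Q Mod A)"
  then obtain x y z where xyz: "x \<in> C" "y \<in> C" "z \<in> C" "X = A #> x" "Y = A #> y" "Z = A #> z"
    by (auto simp: Mod_simps)
  then show "X \<otimes>\<^bsub>Q Mod A\<^esub> Y \<otimes>\<^bsub>Q Mod A\<^esub> Z = X \<otimes>\<^bsub>Q Mod A\<^esub> (Y \<otimes>\<^bsub>Q Mod A\<^esub> Z)"
    using rcos_eq[OF _ assms[of x y z]] by (simp add: Mod_simps rcos_mult)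
qed (auto simp: Mod_simps rcos_mult)

lemma Mod_group_assoc:
  assumes "group (Q Mod A)" and [simp]: "x \<in> C" "y \<in> C" "z \<in> C"
  shows "(x \<otimes> y) \<otimes> z \<in> A #> (x \<otimes> (y \<otimes> z))"
proof -
  interpret group "Q Mod A" by fact
  have "A #> ((x \<otimes> y) \<otimes> z) = A #> (x \<otimes> (y \<otimes> z))"
    using m_assoc[of "A #> x" "A #> y" "A #> z"] by (simp add: Mod_simps rcos_mult)
  then show ?thesis by (simp add: rcos_eq_iff)
qed

lemma Mod_comm_group:
  assumes "group (Q Mod A)"
    and "\<And>x y. \<lbrakk>x \<in> C; y \<in> C\<rbrakk> \<Longrightarrow> x \<otimes> y \<in> A #> (y \<otimes> x)"
  shows "comm_group (Q Mod A)"
proof -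
  interpret group "Q Mod A" by fact
  show ?thesis
  proof (rule group_comm_groupI)
    fix X Y assume "X \<in> carrier (Q Mod A)" "Y \<in> carrier (Q Mod A)"
    then obtain x y where "x \<in> C" "y \<in> C" "X = A #> x" "Y = A #> y"
      by (auto simp: Mod_simps)
    then show "X \<otimes>\<^bsub>Q Mod A\<^esub> Y = Y \<otimes>\<^bsub>Q Mod A\<^esub> X"
      using rcos_eq[OF _ assms(2)[of x y]] by (simp add: Mod_simps rcos_mult)
  qed
qed

lemma Mod_comm_group_commute:
  assumes "comm_group (Q Mod A)" and [simp]: "x \<in> C" "y \<in> C"
  shows "x \<otimes> y \<in> A #> (y \<otimes> x)"
proof -
  interpret comm_group "Q Mod A" by fact
  have "A #> (x \<otimes> y) = A #> (y \<otimes> x)"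
    using m_comm[of "A #> x" "A #> y"] by (simp add: Mod_simps rcos_mult)
  then show ?thesis by (simp add: rcos_eq_iff)
qed

lemma order_Mod:
  assumes "finite C"
  shows "card A * order (Q Mod A) = order Q"
proof -
  have union: "\<Union> ((\<lambda>x. A #> x) ` C) = C"
    using rcos_self rcos_closed by blast
  have "card A * card ((\<lambda>x. A #> x) ` C) = card (\<Union> ((\<lambda>x. A #> x) ` C))"
  proof (rule card_partition)
    fix c assume "c \<in> (\<lambda>x. A #> x) ` C"
    then obtain x where x: "x \<in> C" "c = A #> x" by blast
    have "c = (\<lambda>a. a \<otimes> x) ` A" using x unfolding r_coset_def by auto
    moreover have "inj_on (\<lambda>a. a \<otimes> x) A" using x normal_sub by (auto simp: inj_on_def)
    ultimately show "card c = card A" by (simp add: card_image)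
  next
    fix c d assume "c \<in> (\<lambda>x. A #> x) ` C" "d \<in> (\<lambda>x. A #> x) ` C" "c \<noteq> d"
    then show "c \<inter> d = {}" using rcos_eq by blast
  qed (use assms union in auto)
  then show ?thesis by (simp add: order_def Mod_simps union)
qed

end

end

section \<open>Normal subloops inside the nucleus; a criterion for conjugacy closedness\<close>

context buchsteiner_loop
begin

text \<open>Being stable under conjugation, such subgroups of the nucleus satisfy Bruck's
  conditions; the notion is meant for \<open>N(Q)\<close> and the centre.\<close>

definition act_subgroup :: "'a set \<Rightarrow> bool" where
  "act_subgroup H \<longleftrightarrow> H \<subseteq> N \<and> \<one> \<in> H \<and> (\<forall>a\<in>H. \<forall>b\<in>H. a \<otimes> b \<in> H) \<and> (\<forall>a\<in>H. J a \<in> H) \<and>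
    (\<forall>a\<in>H. \<forall>x\<in>C. a \<star> x \<in> H)"

lemma act_subgroup_normal:
  assumes H: "act_subgroup H"
  shows "normal_subloop H Q"
proof -
  have HN [simp]: "a \<in> N" if "a \<in> H" for a using H that unfolding act_subgroup_def by blast
  have [simp]: "\<one> \<in> H" using H unfolding act_subgroup_def by blast
  have [simp]: "a \<otimes> b \<in> H" if "a \<in> H" "b \<in> H" for a b using H that unfolding act_subgroup_def by blast
  have [simp]: "J a \<in> H" if "a \<in> H" for a using H that unfolding act_subgroup_def by blast
  have [simp]: "a \<star> x \<in> H" if "a \<in> H" "x \<in> C" for a x using H that unfolding act_subgroup_def by blast
  have ldiv: "a \<setminus> b \<in> H" if "a \<in> H" "b \<in> H" for a b
  proof -
    have "a \<setminus> b = J a \<otimes> b" by (rule ldiv_eqI) (use that in simp_all)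
    then show ?thesis using that by simp
  qed
  have rdiv: "b \<oslash> a \<in> H" if "a \<in> H" "b \<in> H" for a b
  proof -
    have "b \<oslash> a = b \<otimes> J a" by (rule rdiv_eqI) (use that in simp_all)
    then show ?thesis using that by simp
  qed
  have swap: "l_coset Q x H = H #> x" if x: "x \<in> C" for x
  proof (intro equalityI subsetI)
    fix v assume "v \<in> l_coset Q x H"
    then obtain a where "a \<in> H" "v = x \<otimes> a" unfolding l_coset_def by blast
    then have "a \<star> J x \<in> H" "v = (a \<star> J x) \<otimes> x" using x nuc_swap_left[of a x] by simp_all
    then show "v \<in> H #> x" unfolding r_coset_def by blast
  next
    fix v assume "v \<in> H #> x"
    then obtain a where "a \<in> H" "v = a \<otimes> x" unfolding r_coset_def by blast
    then have "a \<star> x \<in> H" "v = x \<otimes> (a \<star> x)" using x nuc_swap[of a x] by simp_all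
    then show "v \<in> l_coset Q x H" unfolding l_coset_def by blast
  qed
  have l: "l_coset Q x (l_coset Q y H) = l_coset Q (x \<otimes> y) H" if "x \<in> C" "y \<in> C" for x y
    using that by (simp add: l_coset_def nuc_right)
  have r: "(H #> x) #> y = H #> (x \<otimes> y)" if "x \<in> C" "y \<in> C" for x y
    using that by (simp add: r_coset_def nuc_left)
  show ?thesis
    unfolding normal_subloop_def subloop_def
    by (intro conjI ballI subsetI; (rule swap l r; assumption)?; simp add: ldiv rdiv)
qed

lemma act_subgroup_nucleus: "act_subgroup N"
  unfolding act_subgroup_def by (intro conjI ballI subset_refl one_nuc nuc_mult nuc_inv act_nuc)

text \<open>As \<open>z \<otimes> J z\<close> is nuclear, \<open>J z\<close> is also a right inverse
  of \<open>z\<close> modulo \<open>N\<close>.\<close>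

lemma cong_right_cancel:
  assumes [simp]: "x \<in> C" "y \<in> C" "z \<in> C" and xy: "x \<otimes> z \<sim> y \<otimes> z"
  shows "x \<sim> y"
proof -
  have eq: "u \<otimes> z \<sim> u" if "z \<in> N" "u \<in> C" for z u
    using that by (intro cong_sym[of u]) (auto simp: cong_nuc_def)
  have "(u \<otimes> z) \<otimes> J z \<sim> u" if [simp]: "u \<in> C" for u
  proof -
    have "u \<otimes> (z \<otimes> J z) \<sim> (u \<otimes> z) \<otimes> J z" by (rule cong_assoc) auto
    then have "(u \<otimes> z) \<otimes> J z \<sim> u \<otimes> (z \<otimes> J z)" by (rule cong_sym[rotated]) simp
    then show ?thesis using eq[OF mult_linv_nuc[of z], of u] by (rule cong_trans[rotated]) auto
  qed
  then have "x \<sim> (x \<otimes> z) \<otimes> J z" "(y \<otimes> z) \<otimes> J z \<sim> y"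
    using cong_sym[of "(x \<otimes> z) \<otimes> J z" x] by auto
  moreover have "(x \<otimes> z) \<otimes> J z \<sim> (y \<otimes> z) \<otimes> J z"
    using xy by (rule cong_right[rotated 2]) auto
  ultimately show ?thesis by (meson assms(1) cong_trans)
qed

lemma cong_left_cancel:
  assumes [simp]: "x \<in> C" "y \<in> C" "z \<in> C" and "z \<otimes> x \<sim> z \<otimes> y"
  shows "x \<sim> y"
proof -
  obtain n where n: "n \<in> N" "z \<otimes> y = (z \<otimes> x) \<otimes> n" using assms(4) unfolding cong_nuc_def by blast
  have "z \<otimes> y = z \<otimes> (x \<otimes> n)" unfolding n(2) using n(1) by (simp add: nuc_right)
  then have "y = x \<otimes> n" using n(1) by simp
  then show ?thesis using n(1) unfolding cong_nuc_def by blast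
qed

lemma assoc_map_eq_of_asc:
  assumes "x \<in> C" "y \<in> C" "x' \<in> C" "y' \<in> C" "z \<in> C" "asc x y z = asc x' y' z"
  shows "assoc_map x y z = assoc_map x' y' z"
  using assoc_map_asc[of x y z] assoc_map_asc[of x' y' z] right_cancel[of "asc x y z"] assms
  by (metis assoc_map_closed asc_nuc nuc_carrier)

lemma ltrans_Bij: "x \<in> C \<Longrightarrow> ltrans Q x \<in> carrier (BijGroup C)"
  unfolding ltrans_def BijGroup_def Bij_def
  by (auto intro!: bij_betw_byWitness[where f' = "\<lambda>y. x \<setminus> y"])

lemma rtrans_Bij: "x \<in> C \<Longrightarrow> rtrans Q x \<in> carrier (BijGroup C)"
  unfolding rtrans_def BijGroup_def Bij_def
  by (auto intro!: bij_betw_byWitness[where f' = "\<lambda>y. y \<oslash> x"])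

lemma ltrans_mult:
  "\<lbrakk>x \<in> C; y \<in> C\<rbrakk> \<Longrightarrow> ltrans Q x \<otimes>\<^bsub>BijGroup C\<^esub> ltrans Q y = (\<lambda>u\<in>C. x \<otimes> (y \<otimes> u))"
  using ltrans_Bij[of x] ltrans_Bij[of y]
  by (auto simp: BijGroup_def compose_def ltrans_def fun_eq_iff restrict_def)

lemma rtrans_mult:
  "\<lbrakk>x \<in> C; y \<in> C\<rbrakk> \<Longrightarrow> rtrans Q x \<otimes>\<^bsub>BijGroup C\<^esub> rtrans Q y = (\<lambda>u\<in>C. (u \<otimes> y) \<otimes> x)"
  using rtrans_Bij[of x] rtrans_Bij[of y]
  by (auto simp: BijGroup_def compose_def rtrans_def fun_eq_iff restrict_def)

text \<open>Under the symmetry \<open>assoc_map x y\<close> and \<open>assoc_map y x\<close> agree,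
  and associators depend on classes modulo \<open>N\<close> only. So L_x L_y = L_w L_x once both
  sides agree at \<open>\<one>\<close>; right translations are handled through
  \<open>assoc_map_right\<close>.\<close>

lemma conjugacy_closedI:
  assumes sym: "\<And>x y z. \<lbrakk>x \<in> C; y \<in> C; z \<in> C\<rbrakk> \<Longrightarrow> asc x y z = asc y x z"
  shows "conjugacy_closed Q"
proof -
  interpret S: group "BijGroup C" by (rule group_BijGroup)
  have left: "\<exists>w\<in>C. ltrans Q x \<otimes>\<^bsub>BijGroup C\<^esub> ltrans Q y = ltrans Q w \<otimes>\<^bsub>BijGroup C\<^esub> ltrans Q x"
    if [simp]: "x \<in> C" "y \<in> C" for x y
  proof (rule bexI)
    \<comment> \<open>Evaluation at \<open>\<one>\<close> leaves this as the only candidate.\<close>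
    let ?w = "(x \<otimes> y) \<oslash> x"
    have w: "y \<sim> ?w" by (rule cong_right_cancel[of _ _ x]) (auto simp: cong_commute)
    have "x \<otimes> (y \<otimes> u) = ?w \<otimes> (x \<otimes> u)" if [simp]: "u \<in> C" for u
    proof -
      have "asc ?w x u = asc y x u" by (rule asc_cong1[OF _ _ _ w]) auto
      also have "\<dots> = asc x y u" by (rule sym) auto
      finally have "assoc_map ?w x u = assoc_map x y u" by (intro assoc_map_eq_of_asc) auto
      then show ?thesis using mult_assoc_map[of ?w x u] mult_assoc_map[of x y u] by simp
    qed
    then show "ltrans Q x \<otimes>\<^bsub>BijGroup C\<^esub> ltrans Q y = ltrans Q ?w \<otimes>\<^bsub>BijGroup C\<^esub> ltrans Q x"
      by (simp add: ltrans_mult cong: restrict_cong)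
  qed simp
  have right: "\<exists>w\<in>C. rtrans Q x \<otimes>\<^bsub>BijGroup C\<^esub> rtrans Q y = rtrans Q w \<otimes>\<^bsub>BijGroup C\<^esub> rtrans Q x"
    if [simp]: "x \<in> C" "y \<in> C" for x y
  proof (rule bexI)
    let ?w = "x \<setminus> (y \<otimes> x)"
    have w: "y \<sim> ?w" by (rule cong_left_cancel[of _ _ x]) (auto simp: cong_commute)
    have "(u \<otimes> y) \<otimes> x = (u \<otimes> x) \<otimes> ?w" if [simp]: "u \<in> C" for u
    proof -
      \<comment> \<open>\<open>assoc_map_right\<close> describes right translations at points
        \<open>assoc_map y x v\<close>; every \<open>u\<close> has this form.\<close>
      have "u \<in> assoc_map y x ` C" using assoc_map_bij[of y x] by (simp add: bij_betw_def)
      then obtain v where [simp]: "v \<in> C" and v: "assoc_map y x v = u" by blast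
      have "asc x ?w v = asc x y v" by (rule asc_cong2[OF _ _ _ w]) auto
      also have "\<dots> = asc y x v" by (rule sym) auto
      finally have "assoc_map x ?w v = u" unfolding v[symmetric] by (intro assoc_map_eq_of_asc) auto
      then show ?thesis using assoc_map_right[of y x v] assoc_map_right[of x ?w v] by (simp add: v)
    qed
    then show "rtrans Q x \<otimes>\<^bsub>BijGroup C\<^esub> rtrans Q y = rtrans Q ?w \<otimes>\<^bsub>BijGroup C\<^esub> rtrans Q x"
      by (simp add: rtrans_mult cong: restrict_cong)
  qed simp
  show ?thesis
    unfolding conjugacy_closed_def Let_def
  proof (intro ballI conjI)
    fix x y assume xy: "x \<in> C" "y \<in> C"
    obtain w where "w \<in> C" "ltrans Q x \<otimes>\<^bsub>BijGroup C\<^esub> ltrans Q y = ltrans Q w \<otimes>\<^bsub>BijGroup C\<^esub> ltrans Q x"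
      using left[OF xy] by blast
    then show "ltrans Q x \<otimes>\<^bsub>BijGroup C\<^esub> ltrans Q y \<otimes>\<^bsub>BijGroup C\<^esub> inv\<^bsub>BijGroup C\<^esub> ltrans Q x
        \<in> ltrans Q ` C"
      using xy ltrans_Bij by (simp add: S.m_assoc)
    obtain w where "w \<in> C" "rtrans Q x \<otimes>\<^bsub>BijGroup C\<^esub> rtrans Q y = rtrans Q w \<otimes>\<^bsub>BijGroup C\<^esub> rtrans Q x"
      using right[OF xy] by blast
    then show "rtrans Q x \<otimes>\<^bsub>BijGroup C\<^esub> rtrans Q y \<otimes>\<^bsub>BijGroup C\<^esub> inv\<^bsub>BijGroup C\<^esub> rtrans Q x
        \<in> rtrans Q ` C"
      using xy rtrans_Bij by (simp add: S.m_assoc)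
  qed
qed

subsection \<open>Asymmetry of the associator\<close>

definition asym where
  "asym x y z = asc x y z \<otimes> J (asc y x z)"

lemma asym_V [simp]: "\<lbrakk>x \<in> C; y \<in> C; z \<in> C\<rbrakk> \<Longrightarrow> asym x y z \<in> V"
  unfolding asym_def by simp

lemma V_exchange:
  assumes [simp]: "a \<in> V" "b \<in> V" "p \<in> V" "q \<in> V" and eq: "p \<otimes> b = q \<otimes> a"
  shows "p \<otimes> J a = q \<otimes> J b"
proof -
  have "(p \<otimes> J a) \<otimes> (a \<otimes> b) = p \<otimes> b" by (simp add: nuc_left)
  moreover have "(q \<otimes> J b) \<otimes> (b \<otimes> a) = q \<otimes> a" by (simp add: nuc_left)
  ultimately have "(p \<otimes> J a) \<otimes> (a \<otimes> b) = (q \<otimes> J b) \<otimes> (a \<otimes> b)"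
    using eq V_commute'[of a b] by simp
  then show ?thesis by (subst (asm) right_cancel) auto
qed

lemma V_mult_inv_eq_one: "\<lbrakk>a \<in> V; b \<in> V\<rbrakk> \<Longrightarrow> a \<otimes> J b = \<one> \<longleftrightarrow> a = b"
  using right_cancel[of "J b" a b] by simp

lemma asym_eq_one_iff: "\<lbrakk>x \<in> C; y \<in> C; z \<in> C\<rbrakk> \<Longrightarrow> asym x y z = \<one> \<longleftrightarrow> asc x y z = asc y x z"
  unfolding asym_def by (rule V_mult_inv_eq_one) auto

text \<open>Three exchange rules carry the quotient of \<open>asc x y z \<star> w\<close> by
  \<open>asc x y z\<close> over to that of \<open>asc y x z \<star> w\<close> by
  \<open>asc y x z\<close>. Equality of these quotients means that \<open>w\<close> fixes the
  asymmetry.\<close>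

lemma asym_act:
  assumes [simp]: "x \<in> C" "y \<in> C" "z \<in> C" "w \<in> C"
  shows "asym x y z \<star> w = asym x y z"
proof -
  let ?a = "asc x y z" and ?b = "asc y x z"
  have "(?a \<star> w) \<otimes> J ?a = (asc w y z \<star> x) \<otimes> J (asc w y z)"
    by (rule V_exchange) (auto intro: asc_exchange1)
  also have "\<dots> = (asc w x z \<star> y) \<otimes> J (asc w x z)"
    by (rule V_exchange) (auto intro: asc_exchange2)
  also have "\<dots> = (?b \<star> w) \<otimes> J ?b"
    by (rule V_exchange) (auto intro: asc_exchange1)
  finally have "(?a \<star> w) \<otimes> ?b = (?b \<star> w) \<otimes> ?a"
    using V_exchange[of "J ?b" "J ?a" "?a \<star> w" "?b \<star> w"] by simp
  then have "(?a \<star> w) \<otimes> J (?b \<star> w) = ?a \<otimes> J ?b"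
    using V_exchange[of "?b \<star> w" ?b "?a \<star> w" ?a] V_commute'[of ?a "?b \<star> w"] by simp
  then show ?thesis by (simp add: asym_def act_mult act_inv)
qed

lemma asym_swap: "\<lbrakk>x \<in> C; y \<in> C; z \<in> C\<rbrakk> \<Longrightarrow> asym y x z = J (asym x y z)"
  unfolding asym_def by (simp add: V_inv_mult V_commute')

text \<open>Acting by \<open>x\<close>, \<open>y\<close> and \<open>z\<close> in turn fixes the
  value by \<open>asym_act\<close> and inverts it by \<open>asc_act_all\<close>.\<close>

lemma asym_inv:
  assumes [simp]: "x \<in> C" "y \<in> C" "z \<in> C"
  shows "J (asym x y z) = asym x y z"
proof -
  have "asym x y z = asym x y z \<star> x \<star> y \<star> z" by (simp add: asym_act)
  also have "\<dots> = (asc x y z \<star> x \<star> y \<star> z) \<otimes> J (asc y x z \<star> y \<star> x \<star> z)"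
    by (simp add: asym_def act_mult act_inv act_commute[of "asc y x z" x y])
  also have "\<dots> = J (asym x y z)"
    by (simp add: asc_act_all asym_def V_inv_mult)
  finally show ?thesis by simp
qed

lemma asym_square: "\<lbrakk>x \<in> C; y \<in> C; z \<in> C\<rbrakk> \<Longrightarrow> asym x y z \<otimes> asym x y z = \<one>"
  using nuc_mult_inv(1)[of "asym x y z"] by (simp add: asym_inv)

lemma V_mult_swap:
  assumes [simp]: "a \<in> V" "b \<in> V" "c \<in> V" "d \<in> V"
  shows "(a \<otimes> b) \<otimes> (c \<otimes> d) = (a \<otimes> c) \<otimes> (b \<otimes> d)"
  by (simp add: nuc_left V_left_commute[of b c])

text \<open>Invariance under the action turns the crossed homomorphism rules into plain
  multiplicativity.\<close>

lemma asym_mult1: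
  assumes [simp]: "x \<in> C" "y \<in> C" "z \<in> C" "w \<in> C"
  shows "asym (x \<otimes> w) y z = asym x y z \<otimes> asym w y z"
proof -
  have "asym (x \<otimes> w) y z = ((asc x y z \<star> w) \<otimes> J (asc y x z \<star> w)) \<otimes> asym w y z"
    by (simp add: asym_def asc_mult1 asc_mult2 V_inv_mult V_mult_swap)
  also have "(asc x y z \<star> w) \<otimes> J (asc y x z \<star> w) = asym x y z \<star> w"
    by (simp add: asym_def act_mult act_inv)
  finally show ?thesis by (simp add: asym_act)
qed

lemma asym_swap': "\<lbrakk>x \<in> C; y \<in> C; z \<in> C\<rbrakk> \<Longrightarrow> asym y x z = asym x y z"
  by (simp add: asym_swap[of x y z] asym_inv)

lemma asym_mult2:
  assumes [simp]: "x \<in> C" "y \<in> C" "z \<in> C" "w \<in> C"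
  shows "asym x (y \<otimes> w) z = asym x y z \<otimes> asym x w z"
  using asym_mult1[of y x z w] asym_swap'[of "y \<otimes> w" x z] asym_swap'[of y x z] asym_swap'[of w x z]
  by simp

lemma asym_mult3:
  assumes [simp]: "x \<in> C" "y \<in> C" "z \<in> C" "w \<in> C"
  shows "asym x y (z \<otimes> w) = asym x y z \<otimes> asym x y w"
proof -
  have "asym x y (z \<otimes> w) = ((asc x y z \<star> w) \<otimes> J (asc y x z \<star> w)) \<otimes> asym x y w"
    by (simp add: asym_def asc_mult3 V_inv_mult V_mult_swap)
  also have "(asc x y z \<star> w) \<otimes> J (asc y x z \<star> w) = asym x y z \<star> w"
    by (simp add: asym_def act_mult act_inv)
  finally show ?thesis by (simp add: asym_act)
qed

lemma asym_self: "\<lbrakk>x \<in> C; z \<in> C\<rbrakk> \<Longrightarrow> asym x x z = \<one>"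
  by (simp add: asym_eq_one_iff)

lemma asc_nuc_one:
  assumes "n \<in> N" "x \<in> C" "y \<in> C"
  shows "asc n x y = \<one>" "asc x n y = \<one>" "asc x y n = \<one>"
  using assms by (auto intro!: asc_eqI simp: nuc)

lemma asym_nuc_one:
  assumes "n \<in> N" "x \<in> C" "y \<in> C"
  shows "asym n x y = \<one>" "asym x n y = \<one>" "asym x y n = \<one>"
  using assms by (simp_all add: asym_def asc_nuc_one)

lemma nucleusI_asc:
  assumes "a \<in> C" "\<And>y z. \<lbrakk>y \<in> C; z \<in> C\<rbrakk> \<Longrightarrow> asc a y z = \<one>"
  shows "a \<in> N"
  using assms mult_asc[of a] by (intro nucleusI_left) auto

section \<open>The associator when all squares are nuclear\<close>

context
  assumes squares: "\<And>x. x \<in> C \<Longrightarrow> x \<otimes> x \<in> N"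
begin

text \<open>Expanding \<open>asc (x \<otimes> x) y z = \<one>\<close> shows that acting by
  \<open>x\<close> inverts the associator, which undoes the inversion in
  \<open>asc_rotate\<close>.\<close>

lemma asc_cyclic:
  assumes [simp]: "x \<in> C" "y \<in> C" "z \<in> C"
  shows "asc y z x = asc x y z"
proof -
  have "(asc x y z \<star> x) \<otimes> asc x y z = \<one>"
    using asc_mult1[of x y z x] asc_nuc_one(1)[OF squares[of x], of y z] by simp
  then have "asc x y z = J (asc x y z \<star> x)"
    using V_commute'[of "asc x y z \<star> x" "asc x y z"] by (intro rdiv_eqI[symmetric]) auto
  then show ?thesis using asc_rotate[of x y z] by simp
qed

lemma asym_repeat:
  assumes "x \<in> C" "y \<in> C"
  shows "asym x y x = \<one>" "asym x y y = \<one>"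
  using assms asc_cyclic[of x y x] asc_cyclic[of y x y] by (simp_all add: asym_eq_one_iff)

end

section \<open>Commutators, and homomorphisms blind to the action\<close>

definition commutator where
  "commutator x y = (y \<otimes> x) \<setminus> (x \<otimes> y)"

lemma mult_commutator: "\<lbrakk>x \<in> C; y \<in> C\<rbrakk> \<Longrightarrow> x \<otimes> y = (y \<otimes> x) \<otimes> commutator x y"
  unfolding commutator_def by simp

lemma commutator_eqI: "\<lbrakk>x \<in> C; y \<in> C; a \<in> C; x \<otimes> y = (y \<otimes> x) \<otimes> a\<rbrakk> \<Longrightarrow> commutator x y = a"
  unfolding commutator_def by simp

lemma commutator_nuc [simp]:
  assumes "x \<in> C" "y \<in> C" shows "commutator x y \<in> N"
  using commutes_mod_nuc[OF assms] assms by (auto simp: commutator_def)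

text \<open>Moving \<open>z\<close> leftwards past \<open>y\<close> and then \<open>x\<close> costs
  three reassociations and two commutators.\<close>

lemma commutator_mult:
  assumes [simp]: "x \<in> C" "y \<in> C" "z \<in> C"
  shows "commutator (x \<otimes> y) z =
    asc z x y \<otimes> ((commutator x z \<star> y) \<otimes> (J (asc x z y) \<otimes> (commutator y z \<otimes> asc x y z)))"
proof (rule commutator_eqI)
  let ?k = "commutator x z \<star> y" and ?f = "J (asc x z y) \<otimes> (commutator y z \<otimes> asc x y z)"
  have 1: "x \<otimes> (z \<otimes> y) = ((x \<otimes> z) \<otimes> y) \<otimes> J (asc x z y)"
    by (simp add: mult_asc[of x z y])
  have 2: "(x \<otimes> z) \<otimes> y = (((z \<otimes> x) \<otimes> y) \<otimes> ?k)"
    using mult_commutator[of x z] nuc_mid[of "commutator x z" "z \<otimes> x" y] nuc_swap[of "commutator x z" y]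
      nuc_right[of ?k "z \<otimes> x" y] by simp
  have "(x \<otimes> y) \<otimes> z = (x \<otimes> (y \<otimes> z)) \<otimes> asc x y z" by (rule mult_asc) auto
  also have "x \<otimes> (y \<otimes> z) = (x \<otimes> (z \<otimes> y)) \<otimes> commutator y z"
    using mult_commutator[of y z] nuc_right[of "commutator y z" x "z \<otimes> y"] by simp
  also have "((x \<otimes> (z \<otimes> y)) \<otimes> commutator y z) \<otimes> asc x y z = ((x \<otimes> z) \<otimes> y) \<otimes> ?f"
    unfolding 1 by (simp add: nuc_right)
  also have "\<dots> = ((z \<otimes> (x \<otimes> y)) \<otimes> asc z x y) \<otimes> (?k \<otimes> ?f)"
    unfolding 2 mult_asc[OF assms(3,1,2)] by (simp add: nuc_right)
  also have "\<dots> = (z \<otimes> (x \<otimes> y)) \<otimes> (asc z x y \<otimes> (?k \<otimes> ?f))"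
    by (rule nuc_right) auto
  finally show "(x \<otimes> y) \<otimes> z = (z \<otimes> (x \<otimes> y)) \<otimes> (asc z x y \<otimes> (?k \<otimes> ?f))" .
qed auto

text \<open>A homomorphism on the (commutative) nucleus that does not see the action of the loop cannot
  see the asymmetry of the associator either: compare the two ways of commuting \<open>z\<close> with
  \<open>x y\<close> and with \<open>y x\<close>.\<close>

lemma invariant_hom_asym:
  assumes NV: "\<And>a. a \<in> N \<Longrightarrow> a \<in> V"
    and \<pi>N: "\<And>a. a \<in> N \<Longrightarrow> \<pi> a \<in> N"
    and \<pi>_mult: "\<And>a b. \<lbrakk>a \<in> N; b \<in> N\<rbrakk> \<Longrightarrow> \<pi> (a \<otimes> b) = \<pi> a \<otimes> \<pi> b"
    and \<pi>_asc: "\<And>x y z w. \<lbrakk>x \<in> C; y \<in> C; z \<in> C; w \<in> C\<rbrakk> \<Longrightarrow> \<pi> (asc x y z \<star> w) = \<pi> (asc x y z)"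
    and \<pi>_comm: "\<And>x y w. \<lbrakk>x \<in> C; y \<in> C; w \<in> C\<rbrakk> \<Longrightarrow> \<pi> (commutator x y \<star> w) = \<pi> (commutator x y)"
    and [simp]: "x \<in> C" "y \<in> C" "z \<in> C"
  shows "\<pi> (asym x y z) = \<one>"
proof -
  have \<pi>V [simp]: "\<pi> a \<in> V" if "a \<in> N" for a using NV \<pi>N that by blast
  have \<pi>1: "\<pi> \<one> = \<one>" using \<pi>_mult[of \<one> \<one>] mult_eq_self[of "\<pi> \<one>" "\<pi> \<one>"] \<pi>N[of \<one>] by simp
  have \<pi>J: "\<pi> (J a) = J (\<pi> a)" if [simp]: "a \<in> N" for a
    using \<pi>_mult[of "J a" a] by (intro rdiv_eqI[symmetric]) (simp_all add: \<pi>1)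
  have rot: "\<pi> (asc b c a) = J (\<pi> (asc a b c))" if "a \<in> C" "b \<in> C" "c \<in> C" for a b c
    using that by (simp add: asc_rotate[of a b c] \<pi>J \<pi>_asc)
  have rot2: "\<pi> (asc c a b) = \<pi> (asc a b c)" if "a \<in> C" "b \<in> C" "c \<in> C" for a b c
    using that by (simp add: rot[of b c a] rot[of a b c])
  have comm: "\<pi> (commutator (a \<otimes> b) z) = \<pi> (asc a b z) \<otimes> (\<pi> (commutator a z) \<otimes>
      (\<pi> (asc b a z) \<otimes> (\<pi> (commutator b z) \<otimes> \<pi> (asc a b z))))" if "a \<in> C" "b \<in> C" for a b
    using that by (simp add: commutator_mult \<pi>_mult \<pi>J \<pi>_comm rot2[of a b z] rot[of b a z])
  define p q k l where "p = \<pi> (asc x y z)" and "q = \<pi> (asc y x z)"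
    and "k = \<pi> (commutator x z)" and "l = \<pi> (commutator y z)"
  have [simp]: "p \<in> V" "q \<in> V" "k \<in> V" "l \<in> V" by (auto simp: p_def q_def k_def l_def)
  define u where "u = commutator x y"
  have [simp]: "u \<in> N" by (simp add: u_def)
  \<comment> \<open>Here \<open>x \<otimes> y = (y \<otimes> x) \<otimes> u\<close>, and the extra
    factors \<open>J u\<close> and \<open>u \<star> z\<close> cancel under
    \<open>\<pi>\<close>.\<close>
  have "commutator (x \<otimes> y) z = J u \<otimes> (commutator (y \<otimes> x) z \<otimes> (u \<star> z))"
  proof (rule commutator_eqI)
    have xy: "x \<otimes> y = (y \<otimes> x) \<otimes> u" unfolding u_def by (rule mult_commutator) auto
    have "(x \<otimes> y) \<otimes> z = ((y \<otimes> x) \<otimes> z) \<otimes> (u \<star> z)"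
      unfolding xy using nuc_mid[of u "y \<otimes> x" z] nuc_swap[of u z] nuc_right[of "u \<star> z" "y \<otimes> x" z] by simp
    also have "\<dots> = ((z \<otimes> (y \<otimes> x)) \<otimes> commutator (y \<otimes> x) z) \<otimes> (u \<star> z)"
      by (subst mult_commutator[of "y \<otimes> x" z]) auto
    also have "\<dots> = (z \<otimes> (x \<otimes> y)) \<otimes> (J u \<otimes> (commutator (y \<otimes> x) z \<otimes> (u \<star> z)))"
      unfolding xy using nuc_right[of u z "y \<otimes> x"] by (simp add: nuc_right[symmetric])
    finally show "(x \<otimes> y) \<otimes> z = (z \<otimes> (x \<otimes> y)) \<otimes> (J u \<otimes> (commutator (y \<otimes> x) z \<otimes> (u \<star> z)))" .
  qed auto
  then have "\<pi> (commutator (x \<otimes> y) z) = J (\<pi> u) \<otimes> (\<pi> (commutator (y \<otimes> x) z) \<otimes> \<pi> u)"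
    by (simp add: \<pi>_mult \<pi>J \<pi>_comm u_def)
  also have "\<dots> = \<pi> (commutator (y \<otimes> x) z)"
    using V_commute'[of "\<pi> (commutator (y \<otimes> x) z)" "\<pi> u"] by simp
  \<comment> \<open>Both sides come from \<open>comm\<close>. The values of \<open>\<pi>\<close> lie
    in the commutative group \<open>V\<close>, so all but one \<open>p\<close> and one
    \<open>q\<close> cancel.\<close>
  finally have "p \<otimes> (k \<otimes> (q \<otimes> (l \<otimes> p))) = q \<otimes> (l \<otimes> (p \<otimes> (k \<otimes> q)))"
    by (simp add: comm p_def q_def k_def l_def)
  then have "p \<otimes> (p \<otimes> (q \<otimes> (k \<otimes> l))) = q \<otimes> (p \<otimes> (q \<otimes> (k \<otimes> l)))"
    by (simp only: V_ac \<open>p \<in> V\<close> \<open>q \<in> V\<close> \<open>k \<in> V\<close> \<open>l \<in> V\<close> V_mult V_carrier mult_closed)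
  then have "p = q" by (subst (asm) right_cancel) auto
  then show ?thesis unfolding asym_def by (simp add: \<pi>_mult \<pi>J flip: p_def q_def)
qed

end

subsection \<open>Orders below 64\<close>

context loop
begin

lemma card_double:
  assumes "finite C" "S \<subseteq> C" "w \<in> C" "\<And>a b. \<lbrakk>a \<in> S; b \<in> S\<rbrakk> \<Longrightarrow> a \<noteq> w \<otimes> b"
  shows "card (S \<union> (\<lambda>s. w \<otimes> s) ` S) = 2 * card S"
proof -
  have "inj_on (\<lambda>s. w \<otimes> s) S" using assms(2,3) by (auto simp: inj_on_def subset_iff)
  then have "card ((\<lambda>s. w \<otimes> s) ` S) = card S" by (rule card_image)
  moreover have "S \<inter> (\<lambda>s. w \<otimes> s) ` S = {}" using assms(4) by blast
  moreover have "finite S" using assms(1,2) finite_subset by blast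
  ultimately show ?thesis by (simp add: card_Un_disjoint)
qed

text \<open>Right translation by \<open>h\<close> maps \<open>K\<close> injectively into its
  complement in \<open>S\<close>.\<close>

lemma card_half_le:
  assumes "finite C" "S \<subseteq> C" "K \<subseteq> S" "h \<in> C"
    and "\<And>w. w \<in> K \<Longrightarrow> w \<otimes> h \<in> S - K"
  shows "2 * card K \<le> card S"
proof -
  have fin: "finite S" using assms(1,2) finite_subset by blast
  have "card K = card ((\<lambda>w. w \<otimes> h) ` K)"
    using assms(2,3,4) by (intro card_image[symmetric]) (auto simp: inj_on_def subset_iff)
  also have "\<dots> \<le> card (S - K)" using assms(5) fin by (intro card_mono) auto
  also have "\<dots> = card S - card K" using assms(3) fin finite_subset by (intro card_Diff_subset) auto
  finally show ?thesis using card_mono[OF fin assms(3)] by linarith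
qed

lemma card_half_eq:
  assumes "finite C" "S \<subseteq> C" "K \<subseteq> S" "h \<in> C"
    and "\<And>w. w \<in> K \<Longrightarrow> w \<otimes> h \<in> S - K" "\<And>w. w \<in> S - K \<Longrightarrow> w \<otimes> h \<in> K"
  shows "card S = 2 * card K"
proof -
  have "finite S" "finite K" using assms(1-3) by (auto dest: finite_subset)
  have "2 * card K \<le> card S" using assms by (intro card_half_le) auto
  moreover have "2 * card (S - K) \<le> card S"
    using assms by (intro card_half_le[of _ _ h]) auto
  moreover have "card (S - K) = card S - card K"
    using \<open>finite K\<close> assms(3) by (rule card_Diff_subset)
  ultimately show ?thesis by linarith
qed

end

context buchsteiner_loop
begin

text \<open>The coset of \<open>H\<close> through \<open>w\<close> is disjoint from \<open>H\<close>
  and fits into \<open>K\<close>.\<close>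

lemma card_proper_coset:
  assumes "finite C" "H \<subseteq> N" "\<And>a b. \<lbrakk>a \<in> H; b \<in> H\<rbrakk> \<Longrightarrow> a \<otimes> J b \<in> H"
    and "H \<subseteq> K" "K \<subseteq> C" "w \<in> K" "w \<notin> H" "\<And>a. a \<in> H \<Longrightarrow> w \<otimes> a \<in> K"
  shows "2 * card H \<le> card K"
proof -
  have "a \<noteq> w \<otimes> b" if "a \<in> H" "b \<in> H" for a b
  proof
    assume "a = w \<otimes> b"
    moreover have "b \<in> N" "w \<in> C" using assms that by auto
    ultimately have "w = a \<otimes> J b" by simp
    then show False using assms that by simp
  qed
  then have "card (H \<union> (\<lambda>s. w \<otimes> s) ` H) = 2 * card H"
    using assms by (intro card_double) auto
  moreover have "card (H \<union> (\<lambda>s. w \<otimes> s) ` H) \<le> card K"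
    using assms finite_subset by (intro card_mono) auto
  ultimately show ?thesis by simp
qed

lemma centre_iff: "a \<in> loop_centre Q \<longleftrightarrow> a \<in> N \<and> (\<forall>x\<in>C. a \<star> x = a)"
proof -
  have "a \<star> x = a \<longleftrightarrow> a \<otimes> x = x \<otimes> a" if "a \<in> N" "x \<in> C" for x
    using that left_cancel[of x "a \<star> x" a] nuc_swap[of a x] by auto
  then show ?thesis unfolding loop_centre_def by auto
qed

end

section \<open>A fixed nontrivial asymmetry: kernels and the bound on the nucleus\<close>

locale small_buchsteiner_loop = buchsteiner_loop +
  fixes x0 y0 z0
  assumes finite: "finite C" and small: "card C < 64"
    and x0 [simp]: "x0 \<in> C" and y0 [simp]: "y0 \<in> C" and z0 [simp]: "z0 \<in> C"
    and asym0: "asym x0 y0 z0 \<noteq> \<one>"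
begin

definition t where "t = asym x0 y0 z0"

lemma t_V [simp]: "t \<in> V"
  and t_act [simp]: "w \<in> C \<Longrightarrow> t \<star> w = t"
  and t_square [simp]: "t \<otimes> t = \<one>"
  and t_neq [simp]: "t \<noteq> \<one>"
  using asym0 by (auto simp: t_def asym_act asym_square)

lemma t_inv [simp]: "J t = t"
  by (rule rdiv_eqI) auto

text \<open>\<open>K2\<close> and \<open>K3\<close> intersect kernels of the homomorphisms obtained
  from \<open>asym\<close> by fixing two entries of the triple.\<close>

definition K2 where "K2 = {w \<in> C. asym w y0 z0 = \<one> \<and> asym x0 w z0 = \<one>}"
definition K3 where "K3 = {w \<in> K2. asym x0 y0 w = \<one>}"

text \<open>Translation by \<open>x0\<close> violates the first condition; translation by
  \<open>y0\<close> respects it, because \<open>asym y0 y0 z0 = \<one>\<close>, and violates the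
  second. Each condition thus at least halves the order.\<close>

lemma K2_bound: "4 * card K2 \<le> card C"
proof -
  define K1 where "K1 = {w \<in> C. asym w y0 z0 = \<one>}"
  have "2 * card K1 \<le> card C"
    by (rule card_half_le[of _ _ x0]) (auto simp: finite K1_def asym_mult1 asym0)
  moreover have "2 * card K2 \<le> card K1"
    by (rule card_half_le[of _ _ y0])
      (auto simp: finite K1_def K2_def asym_mult1 asym_mult2 asym_self asym0)
  ultimately show ?thesis by linarith
qed

lemma nuc_K3: "N \<subseteq> K3"
  unfolding K3_def K2_def by (auto simp: asym_nuc_one)

text \<open>With nuclear squares the asymmetry also vanishes when the third entry repeats an earlier
  one, so \<open>z0\<close> lies in \<open>K2\<close> but not in \<open>K3\<close>.\<close>

lemma K3_bound:
  assumes squares: "\<And>x. x \<in> C \<Longrightarrow> x \<otimes> x \<in> N"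
  shows "8 * card K3 \<le> card C"
proof -
  have rep: "asym x y x = \<one>" "asym x y y = \<one>" if "x \<in> C" "y \<in> C" for x y
    using asym_repeat[OF squares] that by blast+
  have "2 * card K3 \<le> card K2"
    by (rule card_half_le[of _ _ z0])
      (auto simp: finite K3_def K2_def asym_mult1 asym_mult2 asym_mult3 rep asym0)
  then show ?thesis using K2_bound by linarith
qed

text \<open>If all squares are nuclear, three kernels give the factor 8. Otherwise a nonnuclear
  square lies in \<open>K2\<close>, as \<open>asym\<close> has values of order at most 2, and
  \<open>N\<close> is proper in \<open>K2\<close>.\<close>

lemma nuc_bound: "8 * card N \<le> card C"
proof (cases "\<forall>x\<in>C. x \<otimes> x \<in> N")
  case True
  have "K3 \<subseteq> C" unfolding K3_def K2_def by auto
  then have "card N \<le> card K3" using nuc_K3 finite finite_subset by (intro card_mono) auto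
  then show ?thesis using K3_bound True by fastforce
next
  case False
  then obtain w where [simp]: "w \<in> C" and w: "w \<otimes> w \<notin> N" by blast
  have "2 * card N \<le> card K2"
  proof (rule card_proper_coset[of _ _ "w \<otimes> w"])
    have "w \<otimes> w \<in> K2" unfolding K2_def by (simp add: asym_mult1 asym_mult2 asym_square)
    then show "w \<otimes> w \<in> K2" "\<And>a. a \<in> N \<Longrightarrow> (w \<otimes> w) \<otimes> a \<in> K2"
      unfolding K2_def by (auto simp: asym_mult1[of "w \<otimes> w"] asym_mult2[of _ "w \<otimes> w"] asym_nuc_one)
    show "N \<subseteq> K2" using nuc_K3 unfolding K3_def by auto
  qed (use w in \<open>auto simp: finite K2_def\<close>)
  then show ?thesis using K2_bound by linarith
qed

lemma nuc_card: "card N < 8"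
  using nuc_bound small by linarith

lemma nuc_sub: "N \<subseteq> C"
  by auto

lemma finite_nuc: "finite N"
  using finite nuc_sub finite_subset by blast

section \<open>The nucleus is commutative of order 4\<close>

lemma two_V: "2 \<le> card V"
proof -
  have "{\<one>, t} \<subseteq> V" by simp
  moreover have "finite V" using finite_nuc by (rule rev_finite_subset) auto
  ultimately have "card {\<one>, t} \<le> card V" by (intro card_mono)
  then show ?thesis using t_neq by simp
qed

text \<open>The centralizer in \<open>N\<close> of a noncentral \<open>a\<close> lies strictly
  between \<open>V\<close> and \<open>N\<close>. Two doublings starting from
  \<open>{\<one>, t}\<close> would give 8 nuclear elements.\<close>

lemma nuc_V: assumes a: "a \<in> N" shows "a \<in> V"
proof (rule ccontr)
  assume aV: "a \<notin> V"
  define Z where "Z = {b \<in> N. a \<otimes> b = b \<otimes> a}"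
  have ZN: "Z \<subseteq> N" and aZ: "a \<in> Z" using a by (auto simp: Z_def)
  have VZ: "V \<subseteq> Z"
  proof
    fix x assume "x \<in> V"
    then show "x \<in> Z" using V_commute[of x a] a by (simp add: Z_def)
  qed
  have Z_mult: "b \<otimes> c \<in> Z" if "b \<in> Z" "c \<in> Z" for b c
  proof -
    have bc: "b \<in> N" "c \<in> N" "a \<otimes> b = b \<otimes> a" "a \<otimes> c = c \<otimes> a" using that by (auto simp: Z_def)
    have "a \<otimes> (b \<otimes> c) = (b \<otimes> a) \<otimes> c" using nuc_left[of a b c] a bc by simp
    also have "\<dots> = (b \<otimes> c) \<otimes> a" using nuc_left[of b a c] nuc_left[of b c a] a bc by simp
    finally show ?thesis using bc by (simp add: Z_def)
  qed
  have Z_inv: "J b \<in> Z" if "b \<in> Z" for b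
  proof -
    have b: "b \<in> N" "a \<otimes> b = b \<otimes> a" using that by (auto simp: Z_def)
    have "b \<otimes> (a \<otimes> J b) = (a \<otimes> b) \<otimes> J b" using nuc_left[of b a "J b"] a b by simp
    also have "\<dots> = b \<otimes> (J b \<otimes> a)" using a b(1) by simp
    finally have "a \<otimes> J b = J b \<otimes> a" by (subst (asm) left_cancel) (use a b(1) in auto)
    then show ?thesis using b by (simp add: Z_def)
  qed
  have "2 * card V \<le> card Z"
    by (rule card_proper_coset[of _ _ a]) (use finite VZ ZN aZ aV Z_mult in \<open>auto\<close>)
  moreover obtain b where b: "b \<in> N" "b \<notin> Z" using a aV unfolding nuc_centre_def Z_def by auto
  moreover have "2 * card Z \<le> card N"
    by (rule card_proper_coset[of _ _ b]) (use finite ZN b Z_mult Z_inv in \<open>auto\<close>)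
  ultimately show False using two_V nuc_card by linarith
qed

lemma nuc_comm: "\<lbrakk>a \<in> N; b \<in> N\<rbrakk> \<Longrightarrow> a \<otimes> b = b \<otimes> a"
  by (rule V_commute[OF nuc_V])

lemma nuc_mult_swap: "\<lbrakk>a \<in> N; b \<in> N; c \<in> N; d \<in> N\<rbrakk> \<Longrightarrow> (a \<otimes> b) \<otimes> (c \<otimes> d) = (a \<otimes> c) \<otimes> (b \<otimes> d)"
  by (rule V_mult_swap) (auto intro: nuc_V)

text \<open>Adjoining \<open>u\<close> to \<open>{\<one>, t}\<close> gives a subgroup of order 4; a
  proper one would force \<open>card N \<ge> 8\<close>.\<close>

lemma four_subgroup:
  assumes u: "u \<in> N" "u \<notin> {\<one>, t}" "u \<otimes> u \<in> {\<one>, t}"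
  shows "card N = 4"
proof -
  define H where "H = {\<one>, t} \<union> (\<lambda>s. u \<otimes> s) ` {\<one>, t}"
  have [simp]: "u \<in> N" "u \<in> C" "u \<in> V" using u nuc_V by auto
  have ut: "t \<otimes> u = u \<otimes> t" by (rule nuc_comm) auto
  have H_eq: "H = {\<one>, t, u, u \<otimes> t}" by (auto simp: H_def)
  have ne: "u \<noteq> \<one>" "u \<noteq> t" "u \<otimes> t \<noteq> \<one>" "u \<otimes> t \<noteq> t" "u \<otimes> t \<noteq> u" "t \<noteq> \<one>"
    using u right_cancel[of t u t] right_cancel[of t u \<one>] by auto
  then have card_H: "card H = 4"
    unfolding H_eq using ne[THEN not_sym] by simp
  have H_mult: "a \<otimes> b \<in> H" if ab: "a \<in> H" "b \<in> H" for a b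
  proof -
    have u_ut: "u \<otimes> (u \<otimes> t) = (u \<otimes> u) \<otimes> t" by (simp add: nuc_left)
    have t_ut: "t \<otimes> (u \<otimes> t) = u" using nuc_left[of t u t] nuc_right[of t u t] ut by simp
    have ut_t: "(u \<otimes> t) \<otimes> t = u" by (simp add: nuc_left)
    have ut_u: "(u \<otimes> t) \<otimes> u = (u \<otimes> u) \<otimes> t" using u_ut ut nuc_left[of u t u] by simp
    have ut_ut: "(u \<otimes> t) \<otimes> (u \<otimes> t) = u \<otimes> u" using nuc_left[of u t "u \<otimes> t"] t_ut by simp
    show ?thesis
      using ab u(3) unfolding H_eq by (auto simp: ut u_ut t_ut ut_t ut_u ut_ut)
  qed
  have H_inv: "J a \<in> H" if "a \<in> H" for a
  proof -
    have aa: "a \<otimes> a \<in> {\<one>, t}" and aN: "a \<in> N"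
      using that u(3) nuc_mult_swap[of u t u t] unfolding H_eq by auto
    then have "J a = a \<or> J a = a \<otimes> t"
    proof -
      have "a \<otimes> a = \<one> \<or> (a \<otimes> t) \<otimes> a = \<one>"
        using aa nuc_comm[of t a] nuc_left[of a t a] nuc_left[of a a t] aN by auto
      then show ?thesis using aN by (auto intro!: rdiv_eqI)
    qed
    then show ?thesis using H_mult[of a t] that by (auto simp: H_eq)
  qed
  have HN: "H \<subseteq> N" unfolding H_eq by auto
  show ?thesis
  proof (rule ccontr)
    assume "card N \<noteq> 4"
    then have "H \<noteq> N" using card_H by auto
    then obtain b where "b \<in> N" "b \<notin> H" using HN by blast
    then have "2 * card H \<le> card N"
      by (intro card_proper_coset[of _ _ b]) (use finite HN H_mult H_inv in \<open>auto\<close>)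
    then show False using card_H nuc_card by simp
  qed
qed

text \<open>If both alternatives fail at \<open>u\<close>, then by \<open>four_subgroup\<close> the
  square of \<open>u\<close> is outside \<open>{\<one>, t}\<close> as well, and the powers of
  \<open>u\<close> with exponents 0 to 3 represent four cosets of \<open>{\<one>, t}\<close>, which
  is too many.\<close>

lemma card_nuc_cases: "card N = 4 \<or> (\<forall>u\<in>N. u \<otimes> (u \<otimes> u) \<in> {\<one>, t})"
proof (rule ccontr)
  assume *: "\<not> ?thesis"
  then obtain u where [simp]: "u \<in> N" and u3: "u \<otimes> (u \<otimes> u) \<notin> {\<one>, t}" by blast
  have [simp]: "u \<in> C" "u \<in> V" using nuc_V by auto
  have u1: "u \<notin> {\<one>, t}" using u3 by auto
  then have u2: "u \<otimes> u \<notin> {\<one>, t}" using four_subgroup[of u] * by auto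
  have ut: "t \<otimes> u = u \<otimes> t" by (rule nuc_comm) auto
  define v where "v = u \<otimes> u"
  have [simp]: "v \<in> N" "v \<in> C" by (auto simp: v_def)
  define S where "S = {\<one>, t} \<union> (\<lambda>s. v \<otimes> s) ` {\<one>, t}"
  have S_eq: "S = {\<one>, t, v, v \<otimes> t}" by (auto simp: S_def)
  have vt: "v \<otimes> t \<noteq> \<one>" "v \<otimes> t \<noteq> t" "v \<noteq> \<one>" "v \<noteq> t" "v \<otimes> t \<noteq> v" "t \<noteq> \<one>"
    using u2 right_cancel[of t v t] right_cancel[of t v \<one>] by (auto simp: v_def)
  have S: "S \<subseteq> N" "card S = 4"
    using vt vt[THEN not_sym] unfolding S_eq by simp_all
  have "card (S \<union> (\<lambda>s. u \<otimes> s) ` S) = 2 * card S"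
  proof (rule card_double)
    have T: "x \<otimes> s \<notin> {\<one>, t}" if "x \<in> C" "x \<notin> {\<one>, t}" "s \<in> {\<one>, t}" for x s
      using that right_cancel[of t x t] right_cancel[of t x \<one>] by auto
    have S_cases: "\<exists>s\<in>{\<one>, t}. b = s \<or> b = u \<otimes> (u \<otimes> s)" if "b \<in> S" for b
      using that unfolding S_eq v_def by (auto simp: nuc_left)
    fix a b assume ab: "a \<in> S" "b \<in> S"
    show "a \<noteq> u \<otimes> b"
    proof
      assume eq: "a = u \<otimes> b"
      obtain s where s: "s \<in> {\<one>, t}" "b = s \<or> b = u \<otimes> (u \<otimes> s)"
        using S_cases[OF ab(2)] by blast
      have [simp]: "s \<in> N" "s \<in> C" using s(1) by auto
      have "u \<otimes> b \<notin> {\<one>, t}"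
        using s(2) T[OF _ u1 s(1)] T[OF _ u3 s(1)] by (auto simp: nuc_left)
      then obtain r where r: "r \<in> {\<one>, t}" "u \<otimes> b = u \<otimes> (u \<otimes> r)"
        using S_cases[OF ab(1)] unfolding eq by metis
      have [simp]: "r \<in> C" "b \<in> C" using r(1) ab(2) S by auto
      have "b = u \<otimes> r" using r(2) by simp
      moreover have "u \<otimes> r \<notin> {\<one>, t}" by (rule T[OF _ u1 r(1)]) simp
      ultimately have "u \<otimes> r = u \<otimes> (u \<otimes> s)" using s by auto
      then have "r = u \<otimes> s" by simp
      then show False using T[OF _ u1 s(1)] r(1) by simp
    qed
  qed (use finite S in auto)
  moreover have "card (S \<union> (\<lambda>s. u \<otimes> s) ` S) \<le> card N"
    using S finite_nuc by (intro card_mono) auto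
  ultimately show False using S nuc_card by simp
qed

text \<open>Otherwise cubing maps \<open>N\<close> into \<open>{\<one>, t}\<close>, where the action
  is trivial. By \<open>invariant_hom_asym\<close> it kills \<open>t\<close>, yet the cube of
  \<open>t\<close> is \<open>t\<close>.\<close>

lemma card_nuc: "card N = 4"
proof (rule ccontr)
  assume "card N \<noteq> 4"
  then have cube: "u \<otimes> (u \<otimes> u) \<in> {\<one>, t}" if "u \<in> N" for u using card_nuc_cases that by blast
  have fixed: "s \<star> w = s" if "s \<in> {\<one>, t}" "w \<in> C" for s w using that by auto
  define \<pi> where "\<pi> = (\<lambda>u. u \<otimes> (u \<otimes> u))"
  have \<pi>_mult: "\<pi> (a \<otimes> b) = \<pi> a \<otimes> \<pi> b" if "a \<in> N" "b \<in> N" for a b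
    unfolding \<pi>_def using that by (simp add: nuc_mult_swap[of a b a b] nuc_mult_swap[of a b "a \<otimes> a" "b \<otimes> b"])
  have \<pi>_act: "\<pi> (a \<star> w) = \<pi> a" if "a \<in> N" "w \<in> C" for a w
  proof -
    have "\<pi> (a \<star> w) = \<pi> a \<star> w" unfolding \<pi>_def using that by (simp add: act_mult)
    also have "\<dots> = \<pi> a" using fixed[OF cube] that by (simp add: \<pi>_def)
    finally show ?thesis .
  qed
  have "\<pi> t = \<one>"
    unfolding t_def
    by (rule invariant_hom_asym) (auto simp: nuc_V \<pi>_mult \<pi>_act, simp add: \<pi>_def)
  then show False by (simp add: \<pi>_def)
qed

text \<open>For a trivial action, \<open>invariant_hom_asym\<close> would apply to the identity map
  and give \<open>t = \<one>\<close>.\<close>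

lemma act_nontrivial: "\<exists>a\<in>N. \<exists>w\<in>C. a \<star> w \<noteq> a"
proof (rule ccontr)
  assume "\<not> ?thesis"
  then have act: "a \<star> w = a" if "a \<in> N" "w \<in> C" for a w using that by blast
  have "(\<lambda>a. a) t = \<one>"
    unfolding t_def by (rule invariant_hom_asym) (auto simp: nuc_V act)
  then show False by simp
qed

section \<open>Nuclear elements outside \<open>{\<one>, t}\<close> and the values of the
  associator\<close>

lemma nuc_cases:
  assumes u: "u \<in> N" "u \<notin> {\<one>, t}" and v: "v \<in> N"
  shows "v \<in> {\<one>, t} \<or> v = u \<or> v = u \<otimes> t"
proof -
  have ne: "u \<noteq> \<one>" "u \<noteq> t" "u \<otimes> t \<noteq> \<one>" "u \<otimes> t \<noteq> t" "u \<otimes> t \<noteq> u" "t \<noteq> \<one>"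
    using u right_cancel[of t u t] right_cancel[of t u \<one>] by auto
  then have "card {\<one>, t, u, u \<otimes> t} = 4"
    using ne[THEN not_sym] by simp
  moreover have "{\<one>, t, u, u \<otimes> t} \<subseteq> N" using u by simp
  ultimately have "{\<one>, t, u, u \<otimes> t} = N"
    using card_nuc finite_nuc by (intro card_subset_eq) auto
  then show ?thesis using v by auto
qed

lemma T_act: "\<lbrakk>s \<in> {\<one>, t}; w \<in> C\<rbrakk> \<Longrightarrow> s \<star> w = s"
  by auto

lemma act_cases:
  assumes u: "u \<in> N" "u \<notin> {\<one>, t}" and w: "w \<in> C"
  shows "u \<star> w = u \<or> u \<star> w = u \<otimes> t"
proof -
  have "u \<star> w \<notin> {\<one>, t}"
  proof
    assume T: "u \<star> w \<in> {\<one>, t}"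
    then have "(u \<star> w) \<star> w = u \<star> w" using w by (rule T_act)
    then have "u \<star> w = u" using u w by simp
    then show False using T u by simp
  qed
  then show ?thesis using nuc_cases[OF u, of "u \<star> w"] u w by auto
qed

text \<open>Elements of \<open>N\<close> outside \<open>{\<one>, t}\<close> differ at most by the
  factor \<open>t\<close>, which the action fixes.\<close>

lemma act_transfer:
  assumes u: "u \<in> N" "u \<notin> {\<one>, t}" and v: "v \<in> N" "v \<notin> {\<one>, t}"
    and w: "w \<in> C" and "u \<star> w \<noteq> u"
  shows "v \<star> w \<noteq> v"
proof
  assume vw: "v \<star> w = v"
  have "u = v \<or> u = v \<otimes> t" using nuc_cases[OF v u(1)] u(2) by blast
  then have "u \<star> w = u" using v w vw by (auto simp: act_mult)
  then show False using assms by simp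
qed

text \<open>If \<open>w\<close> moves \<open>p\<close>, it does so by the factor \<open>t\<close>,
  which the equation passes on to \<open>q\<close>. This serves to replace arguments of an
  associator one by one.\<close>

lemma exchange_step:
  assumes p: "p \<in> N" "p \<notin> {\<one>, t}" and [simp]: "q \<in> N" "x \<in> C" "w \<in> C"
    and eq: "(p \<star> w) \<otimes> q = (q \<star> x) \<otimes> p" and pw: "p \<star> w \<noteq> p"
  shows "q \<notin> {\<one>, t} \<and> q \<star> x \<noteq> q"
proof -
  have "p \<star> w = p \<otimes> t" using act_cases[OF p \<open>w \<in> C\<close>] pw by simp
  then have "(q \<star> x) \<otimes> p = (p \<otimes> t) \<otimes> q" using eq by simp
  also have "\<dots> = (t \<otimes> q) \<otimes> p"
    using nuc_left[of p t q] nuc_comm[of p "t \<otimes> q"] p by simp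
  finally have "q \<star> x = t \<otimes> q" using p by simp
  moreover have "t \<otimes> q \<noteq> q" using right_cancel[of q t \<one>] by simp
  ultimately show ?thesis using T_act[of q x] by auto
qed

text \<open>From an associator outside \<open>{\<one>, t}\<close>, exchange steps lead to
  \<open>asc w w w\<close> outside, with \<open>w\<close> acting nontrivially. Then \<open>N\<close>
  is cyclic and the square of \<open>w\<close> is nuclear, which contradicts the possible actions of
  \<open>w\<close> on that square.\<close>

lemma asc_T:
  assumes [simp]: "x \<in> C" "y \<in> C" "z \<in> C"
  shows "asc x y z \<in> {\<one>, t}"
proof (rule ccontr)
  assume f: "asc x y z \<notin> {\<one>, t}"
  obtain a w where a: "a \<in> N" and w [simp]: "w \<in> C" and aw: "a \<star> w \<noteq> a"
    using act_nontrivial by blast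
  have aT: "a \<notin> {\<one>, t}" using T_act[OF _ w] aw by blast
  have moved: "v \<star> w \<noteq> v" if "v \<in> N" "v \<notin> {\<one>, t}" for v
    by (rule act_transfer[OF a aT that w aw])
  have 1: "asc w y z \<notin> {\<one>, t}"
    using exchange_step[OF _ f _ _ _ asc_exchange1[of x y z w]] moved[OF _ f] by simp
  have 2: "asc w w z \<notin> {\<one>, t}"
    using exchange_step[OF _ 1 _ _ _ asc_exchange2[of w y z w]] moved[OF _ 1] by simp
  have r: "asc w w w \<notin> {\<one>, t}"
    using exchange_step[OF _ 2 _ _ _ asc_exchange3[of w w z w]] moved[OF _ 2] by simp
  define r where "r = asc w w w"
  have [simp]: "r \<in> N" "r \<in> C" and rT: "r \<notin> {\<one>, t}" using r by (auto simp: r_def)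
  have rw: "r \<star> w = r \<otimes> t" using act_cases[OF _ rT, of w] moved[OF _ rT] by simp
  \<comment> \<open>By \<open>asc_square_act\<close>, two of the three actions in
    \<open>asc_act_all\<close> have no effect.\<close>
  have "r \<star> w = J r" using asc_act_all[of w w w] by (simp add: asc_square_act r_def)
  then have "r \<otimes> (r \<otimes> t) = \<one>" using rw by simp
  then have rr: "r \<otimes> r = t"
    using right_cancel[of t "r \<otimes> r" t] by (simp add: nuc_left)
  \<comment> \<open>Such \<open>g\<close> is \<open>r\<close> or \<open>r \<otimes> t\<close> and
    has square \<open>t\<close>; hence \<open>g \<otimes> t\<close>, its image under
    \<open>w\<close>, is its inverse.\<close>
  have square: "g \<otimes> t \<otimes> g = \<one>" if g: "g \<in> N" "g \<notin> {\<one>, t}" for g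
  proof -
    have gtg: "g \<otimes> t \<otimes> g = t \<otimes> (g \<otimes> g)"
      using g nuc_comm[of g t] nuc_left[of t g g] by simp
    have "g \<otimes> g = t" using nuc_cases[OF _ rT g(1)] g(2) rr nuc_mult_swap[of r t r t] by auto
    then show ?thesis unfolding gtg by simp
  qed
  have "w \<otimes> w \<in> N"
  proof (rule nucleusI_asc)
    fix y z assume [simp]: "y \<in> C" "z \<in> C"
    have "asc (w \<otimes> w) y z = (asc w y z \<star> w) \<otimes> asc w y z" by (simp add: asc_mult1)
    also have "\<dots> = \<one>"
    proof (cases "asc w y z \<in> {\<one>, t}")
      case True
      then show ?thesis using T_act[OF True, of w] by auto
    next
      case False
      then show ?thesis using act_cases[OF _ False, of w] moved[OF _ False] square[OF _ False] by simp
    qed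
    finally show "asc (w \<otimes> w) y z = \<one>" .
  qed simp
  define n where "n = w \<otimes> w"
  have [simp]: "n \<in> N" "n \<in> C" using \<open>w \<otimes> w \<in> N\<close> by (simp_all add: n_def)
  \<comment> \<open>The two bracketings of the cube of \<open>w\<close> show that acting by
    \<open>w\<close> multiplies \<open>n\<close> by \<open>r\<close>, whereas only the factors
    \<open>\<one>\<close> and \<open>t\<close> are possible.\<close>
  have "n \<otimes> w = (w \<otimes> n) \<otimes> r"
    unfolding n_def r_def by (rule mult_asc) auto
  also have "\<dots> = w \<otimes> (n \<otimes> r)" by (rule nuc_right) auto
  finally have nr: "n \<star> w = n \<otimes> r" by (intro act_eqI) auto
  have "n \<otimes> r = n \<or> n \<otimes> r = n \<otimes> t"
    using act_cases[of n w] T_act[of n w] by (auto simp: nr)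
  then show False using rT by auto
qed

section \<open>Nuclear squares and the order of \<open>Q\<close>\<close>

lemma squares: "x \<in> C \<Longrightarrow> x \<otimes> x \<in> N"
proof (rule nucleusI_asc)
  fix y z assume [simp]: "x \<in> C" "y \<in> C" "z \<in> C"
  show "asc (x \<otimes> x) y z = \<one>"
    using asc_T[of x y z] T_act[OF asc_T[of x y z], of x] by (auto simp: asc_mult1)
qed simp

lemma asym_T: "\<lbrakk>x \<in> C; y \<in> C; z \<in> C\<rbrakk> \<Longrightarrow> asym x y z \<in> {\<one>, t}"
  using asc_T[of x y z] asc_T[of y x z] by (auto simp: asym_def)

text \<open>As \<open>asym\<close> takes only the values \<open>\<one>\<close> and \<open>t\<close>,
  each kernel has index exactly 2. If \<open>N\<close> were proper in \<open>K3\<close>, the order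
  would be at least 64.\<close>

lemma card_carrier: "card C = 32"
proof -
  have rep: "asym x y x = \<one>" "asym x y y = \<one>" if "x \<in> C" "y \<in> C" for x y
    using asym_repeat[OF squares] that by blast+
  define K1 where "K1 = {w \<in> C. asym w y0 z0 = \<one>}"
  have "card C = 2 * card K1"
  proof (rule card_half_eq[of _ _ x0])
    fix w assume "w \<in> C - K1"
    then show "w \<otimes> x0 \<in> K1"
      using asym_T[of w y0 z0] by (auto simp: K1_def asym_mult1 simp flip: t_def)
  qed (auto simp: finite K1_def asym_mult1 asym0)
  moreover have "card K1 = 2 * card K2"
  proof (rule card_half_eq[of _ _ y0])
    fix w assume "w \<in> K1 - K2"
    then show "w \<otimes> y0 \<in> K2"
      using asym_T[of x0 w z0]
      by (auto simp: K1_def K2_def asym_mult1 asym_mult2 asym_self simp flip: t_def)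
  qed (auto simp: finite K1_def K2_def asym_mult1 asym_mult2 asym_self asym0)
  moreover have "card K2 = 2 * card K3"
  proof (rule card_half_eq[of _ _ z0])
    fix w assume "w \<in> K2 - K3"
    then show "w \<otimes> z0 \<in> K3"
      using asym_T[of x0 y0 w]
      by (auto simp: K3_def K2_def asym_mult1 asym_mult2 asym_mult3 rep simp flip: t_def)
  qed (auto simp: finite K3_def K2_def asym_mult1 asym_mult2 asym_mult3 rep asym0)
  ultimately have C: "card C = 8 * card K3" by simp
  have "K3 = N"
  proof (rule ccontr)
    assume "K3 \<noteq> N"
    then obtain w where w: "w \<in> K3" "w \<notin> N" using nuc_K3 by blast
    have "2 * card N \<le> card K3"
      by (rule card_proper_coset[OF _ _ _ nuc_K3 _ w])
        (use w in \<open>auto simp: finite K3_def K2_def asym_mult1 asym_mult2 asym_mult3 asym_nuc_one\<close>)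
    then show False using C small card_nuc by simp
  qed
  then show ?thesis using C card_nuc by simp
qed

section \<open>The centre, the associator subloop and the quotients\<close>

lemma centre_eq: "loop_centre Q = {\<one>, t}"
proof -
  obtain a w where a: "a \<in> N" and w: "w \<in> C" and aw: "a \<star> w \<noteq> a"
    using act_nontrivial by blast
  have aT: "a \<notin> {\<one>, t}" using T_act[OF _ w] aw by blast
  \<comment> \<open>By \<open>act_transfer\<close> the single \<open>w\<close> moves every element
    of \<open>N\<close> outside \<open>{\<one>, t}\<close>.\<close>
  have "u \<in> {\<one>, t}" if "u \<in> loop_centre Q" for u
    using act_transfer[OF a aT _ _ w aw, of u] that w unfolding centre_iff by blast
  moreover have "u \<in> loop_centre Q" if "u \<in> {\<one>, t}" for u
    using T_act[OF that] that by (auto simp: centre_iff)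
  ultimately show ?thesis by blast
qed

lemma act_subgroup_centre: "act_subgroup {\<one>, t}"
  unfolding act_subgroup_def by auto

lemma Mod_nucleus:
  "comm_group (Q Mod N)" "\<And>X. X \<in> carrier (Q Mod N) \<Longrightarrow> X [^]\<^bsub>Q Mod N\<^esub> (2::nat) = \<one>\<^bsub>Q Mod N\<^esub>"
  "order (Q Mod N) = 8"
proof -
  note N = act_subgroup_normal[OF act_subgroup_nucleus]
  have cong: "y \<in> N #> x" if "x \<in> C" "x \<sim> y" for x y
    using cong_left_factor[OF that] by (auto simp: rcos_mem_iff)
  have group: "group (Q Mod N)"
    by (rule Mod_group[OF N]) (auto intro!: cong cong_assoc)
  show "comm_group (Q Mod N)"
    by (rule Mod_comm_group[OF N group]) (auto intro!: cong cong_commute)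
  show "order (Q Mod N) = 8"
    using order_Mod[OF N finite] card_nuc card_carrier by (simp add: order_def)
  fix X assume "X \<in> carrier (Q Mod N)"
  then obtain x where x: "x \<in> C" "X = N #> x" by (auto simp: Mod_simps[OF N])
  interpret group "Q Mod N" by (rule group)
  have "X [^]\<^bsub>Q Mod N\<^esub> (2::nat) = X \<otimes>\<^bsub>Q Mod N\<^esub> X"
    by (simp only: numeral_2_eq_2 nat_pow_Suc nat_pow_0 l_one[OF \<open>X \<in> carrier (Q Mod N)\<close>])
  also have "\<dots> = N #> (x \<otimes> x)" using x by (simp add: Mod_simps[OF N] rcos_mult[OF N])
  finally show "X [^]\<^bsub>Q Mod N\<^esub> (2::nat) = \<one>\<^bsub>Q Mod N\<^esub>"
    using squares x by (simp add: rcos_normal[OF N] Mod_simps[OF N])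
qed

text \<open>Associators lie in \<open>{\<one>, t}\<close>, whence the group. Were it commutative,
  commutators would lie there too and be fixed by the action, and \<open>invariant_hom_asym\<close>
  for the identity map would give \<open>t = \<one>\<close>.\<close>

lemma Mod_centre:
  "group (Q Mod {\<one>, t})" "\<not> comm_group (Q Mod {\<one>, t})" "order (Q Mod {\<one>, t}) = 16"
proof -
  note Z = act_subgroup_normal[OF act_subgroup_centre]
  have swap: "s \<otimes> x = x \<otimes> s" if "s \<in> {\<one>, t}" "x \<in> C" for s x
  proof -
    have "s \<in> N" using that by auto
    then show ?thesis using nuc_swap[of s x] T_act[OF that] that(2) by simp
  qed
  show "group (Q Mod {\<one>, t})"
  proof (rule Mod_group[OF Z])
    fix x y z assume [simp]: "x \<in> C" "y \<in> C" "z \<in> C"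
    have "(x \<otimes> y) \<otimes> z = asc x y z \<otimes> (x \<otimes> (y \<otimes> z))"
      using mult_asc[of x y z] swap[OF asc_T[of x y z]] by simp
    then show "(x \<otimes> y) \<otimes> z \<in> {\<one>, t} #> (x \<otimes> (y \<otimes> z))"
      unfolding rcos_mem_iff by (rule bexI) (rule asc_T; simp)
  qed
  show "order (Q Mod {\<one>, t}) = 16"
    using order_Mod[OF Z finite] t_neq[THEN not_sym] card_carrier by (simp add: order_def)
  show "\<not> comm_group (Q Mod {\<one>, t})"
  proof
    assume comm: "comm_group (Q Mod {\<one>, t})"
    have T: "commutator x y \<in> {\<one>, t}" if xy: "x \<in> C" "y \<in> C" for x y
    proof -
      obtain s where s: "s \<in> {\<one>, t}" "x \<otimes> y = s \<otimes> (y \<otimes> x)"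
        using Mod_comm_group_commute[OF Z comm xy] unfolding rcos_mem_iff by (elim bexE)
      have "x \<otimes> y = (y \<otimes> x) \<otimes> s" unfolding s(2) by (rule swap[OF s(1)]) (use xy in simp)
      moreover have "s \<in> C" using s(1) by auto
      ultimately have "commutator x y = s" using xy by (intro commutator_eqI)
      then show ?thesis using s by simp
    qed
    have "(\<lambda>a. a) t = \<one>"
      unfolding t_def
      by (rule invariant_hom_asym) (auto simp: nuc_V T_act[OF asc_T] T_act[OF T])
    then show False by simp
  qed
qed

lemma associator_subloop_eq: "associator_subloop Q = {\<one>, t}"
  unfolding associator_subloop_def
proof (rule Least_equality)
  show "normal_subloop {\<one>, t} Q \<and> group (Q Mod {\<one>, t})"
    using act_subgroup_normal[OF act_subgroup_centre] Mod_centre(1) by blast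
next
  fix A assume A: "normal_subloop A Q \<and> group (Q Mod A)"
  \<comment> \<open>As the asymmetry of the triple is not \<open>\<one>\<close>, one of its two
    associators is \<open>t\<close>; every \<open>A\<close> whose quotient is a group contains
    it.\<close>
  have "asc x0 y0 z0 = t \<or> asc y0 x0 z0 = t"
    using asc_T[of x0 y0 z0] asc_T[of y0 x0 z0] asym0 by (auto simp: asym_def)
  then obtain x y z where [simp]: "x \<in> C" "y \<in> C" "z \<in> C" and asc: "asc x y z = t"
    using x0 y0 z0 by blast
  obtain a where a: "a \<in> A" "(x \<otimes> y) \<otimes> z = a \<otimes> (x \<otimes> (y \<otimes> z))"
    using Mod_group_assoc[of A x y z] A unfolding rcos_mem_iff by auto
  have "a \<otimes> (x \<otimes> (y \<otimes> z)) = t \<otimes> (x \<otimes> (y \<otimes> z))"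
    using mult_asc[of x y z] a nuc_swap[of t "x \<otimes> (y \<otimes> z)"] by (simp add: asc)
  then have "a = t" using a normal_sub[of A a] A by simp
  then show "{\<one>, t} \<le> A" using a normal_one[of A] A by simp
qed

end

theorem proposition4p8:
  fixes Q :: "('a, 'b) monoid_scheme"
  assumes "buchsteiner_loop Q"
    and "finite (carrier Q)" and "order Q < 64"
    and "\<not> conjugacy_closed Q"
  shows "order Q = 32 \<and>
    (elementary_abelian (Q Mod nucleus Q) \<and> order (Q Mod nucleus Q) = 8) \<and>
    (loop_centre Q = associator_subloop Q \<and> card (loop_centre Q) = 2) \<and>
    (group (Q Mod loop_centre Q) \<and> \<not> comm_group (Q Mod loop_centre Q) \<and>
      order (Q Mod loop_centre Q) = 16)"
proof -
  interpret buchsteiner_loop Q by fact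
  \<comment> \<open>By \<open>conjugacy_closedI\<close> some asymmetry is nontrivial.\<close>
  obtain x y z where "x \<in> carrier Q" "y \<in> carrier Q" "z \<in> carrier Q" "asym x y z \<noteq> \<one>\<^bsub>Q\<^esub>"
    using conjugacy_closedI assms(4) asym_eq_one_iff by metis
  then interpret small_buchsteiner_loop Q x y z
    using assms(2,3) by unfold_locales (auto simp: order_def)
  have "elementary_abelian (Q Mod nucleus Q)"
    unfolding elementary_abelian_def using Mod_nucleus(1,2) two_is_prime_nat by blast
  moreover have "card (loop_centre Q) = 2" using t_neq[THEN not_sym] by (simp add: centre_eq)
  ultimately show ?thesis
    using card_carrier Mod_nucleus(3) Mod_centre by (simp add: order_def centre_eq associator_subloop_eq)
qed

end
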